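(* \textsc{Tomography under Window Constraints} is polynomial-time solvable if the instances are restricted to satisfy the following two properties: (i) For every $\tau\in[t]$ and $i\in[l_\tau],$ $W_i^{(\tau)}\subseteq \mathbb{Z}\times \{p_{i,\tau}\}$ or $W_i^{(\tau)}\subseteq \{p_{i,\tau}\}\times\mathbb{Z}$, for some $p_{i,\tau} \in G^{(\tau)}$; (ii) For every $\tau\in[t]$ and $i\neq j \in [l_\tau]$ it holds that $W_i^{(\tau)}\cap W_j^{(\tau)}=\emptyset.$
   Context: Setting: $d=2$ with X-rays in the two coordinate directions $S_1,S_2$ of $\R^2$. For each $\tau\in[t]$ the X-ray data (numbers of points on each horizontal and vertical line) determine a candidate grid $G^{(\tau)}$ with points $g_j^{(\tau)}$ and binary variables $\xi_j^{(\tau)}$ (incidence vector $x^{(\tau)}$), and the X-ray constraints read $A^{(\tau)}x^{(\tau)}=b^{(\tau)}$. Additionally, nonempty windows $W_1^{(\tau)},\dots,W_{l_\tau}^{(\tau)}\subseteq G^{(\tau)}$ (identified with index sets) with pairs $(\sim_i^{(\tau)},k_i^{(\tau)})\in\{\le,=,\ge\}\times\N_0$ are given. \textsc{Tomography under Window Constraints} asks for solutions of the ILPs $A^{(\tau)}x^{(\tau)}=b^{(\tau)}$, $\sum_{j\in W_i^{(\tau)}}\xi_j^{(\tau)}\sim_i^{(\tau)}k_i^{(\tau)}$ ($i\in[l_\tau]$), $x^{(\tau)}\in\{0,1\}^{|G^{(\tau)}|}$, for all $\tau\in[t]$. *)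

theory Defs
  imports "HOL-Computational_Algebra.Polynomial"
begin

section \<open>Polynomial time\<close>

text \<open>
  The model of computation is first-order pure Lisp, with binary trees as data and with the
  number of evaluation steps as running time (compare the languages WHILE and F in N. D. Jones,
  Computability and Complexity from a Programming Perspective, MIT Press 1997). The only
  operations on data are construction, projection and the test for \<open>Leaf\<close>; in particular there
  is neither arithmetic nor a comparison of trees at unit cost. An interpreter that represents
  trees by pointers spends constant time per step, so that this model and Turing machines
  simulate each other with polynomial overhead.
\<close>

datatype data = Leaf | Node data data

datatype expr =
    Arg nat
  | Lf
  | Nd expr expr
  | Left expr
  | Right expr
  | If expr expr expr
  | Call nat "expr list"

text \<open>
  A program is a finite list of (mutually recursive) function bodies; \<open>Arg i\<close> is the \<open>i\<close>-th
  argument of the function being executed and \<open>Call f\<close> calls the \<open>f\<close>-th function by value.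
  Function \<open>0\<close> is the main function.
\<close>

type_synonym prog = "expr list"

fun left :: "data \<Rightarrow> data" where
  "left Leaf = Leaf"
| "left (Node l r) = l"

fun right :: "data \<Rightarrow> data" where
  "right Leaf = Leaf"
| "right (Node l r) = r"

text \<open>
  \<open>eval P env e v n\<close>: with arguments \<open>env\<close>, the expression \<open>e\<close> evaluates to \<open>v\<close> in \<open>n\<close> steps.
\<close>

inductive eval :: "prog \<Rightarrow> data list \<Rightarrow> expr \<Rightarrow> data \<Rightarrow> nat \<Rightarrow> bool"
  and evals :: "prog \<Rightarrow> data list \<Rightarrow> expr list \<Rightarrow> data list \<Rightarrow> nat \<Rightarrow> bool"
  for P :: prog
where
  Arg: "i < length env \<Longrightarrow> eval P env (Arg i) (env ! i) 1"
| Lf: "eval P env Lf Leaf 1"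
| Nd: "eval P env e1 v1 n1 \<Longrightarrow> eval P env e2 v2 n2 \<Longrightarrow>
    eval P env (Nd e1 e2) (Node v1 v2) (1 + n1 + n2)"
| Left: "eval P env e v n \<Longrightarrow> eval P env (Left e) (left v) (1 + n)"
| Right: "eval P env e v n \<Longrightarrow> eval P env (Right e) (right v) (1 + n)"
| IfNode: "eval P env b u m \<Longrightarrow> u \<noteq> Leaf \<Longrightarrow> eval P env e1 v n \<Longrightarrow>
    eval P env (If b e1 e2) v (1 + m + n)"
| IfLeaf: "eval P env b Leaf m \<Longrightarrow> eval P env e2 v n \<Longrightarrow>
    eval P env (If b e1 e2) v (1 + m + n)"
| Call: "f < length P \<Longrightarrow> evals P env es vs m \<Longrightarrow> eval P vs (P ! f) v n \<Longrightarrow>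
    eval P env (Call f es) v (1 + m + n)"
| Empty: "evals P env [] [] 0"
| Args: "eval P env e v m \<Longrightarrow> evals P env es vs n \<Longrightarrow>
    evals P env (e # es) (v # vs) (m + n)"

lemma eval_deterministic:
  "eval P env e v n \<Longrightarrow> eval P env e v' n' \<Longrightarrow> v' = v \<and> n' = n"
  and evals_deterministic:
  "evals P env es vs n \<Longrightarrow> evals P env es vs' n' \<Longrightarrow> vs' = vs \<and> n' = n"
proof (induction arbitrary: v' n' and vs' n' rule: eval_evals.inducts)
  case (Arg i env)
  then show ?case by (auto elim: eval.cases)
next
  case (Lf env)
  then show ?case by (auto elim: eval.cases)
next
  case (Nd env e1 v1 n1 e2 v2 n2)
  from Nd.prems show ?case by cases (use Nd.IH in blast)
next
  case (Left env e v n)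
  from Left.prems show ?case by cases (use Left.IH in blast)
next
  case (Right env e v n)
  from Right.prems show ?case by cases (use Right.IH in blast)
next
  case (IfNode env b u m e1 v n e2)
  from IfNode.prems show ?case by cases (use IfNode.IH IfNode.hyps in blast)+
next
  case (IfLeaf env b m e2 v n e1)
  from IfLeaf.prems show ?case by cases (use IfLeaf.IH in blast)+
next
  case (Call f env es vs m v n)
  from Call.prems show ?case by cases (use Call.IH in blast)
next
  case (Empty env)
  then show ?case by (auto elim: evals.cases)
next
  case (Args env e v m es vs n)
  from Args.prems show ?case by cases (use Args.IH in blast)
qed

definition run :: "prog \<Rightarrow> data \<Rightarrow> data \<Rightarrow> nat \<Rightarrow> bool" where
  "run P input output n \<longleftrightarrow> eval P [input] (Call 0 [Arg 0]) output n"

fun enc_option :: "('a \<Rightarrow> data) \<Rightarrow> 'a option \<Rightarrow> data" where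
  "enc_option enc None = Leaf"
| "enc_option enc (Some a) = Node (enc a) Leaf"

text \<open>
  Search problems: on every instance in \<open>Inst\<close> the program has to output a solution, or the
  answer that there is none, in time polynomial in the size of the encoded instance. The size of
  the output is counted separately, as shared subtrees may make it exceed the number of steps.
\<close>

definition poly_time_solvable ::
  "('i \<Rightarrow> data) \<Rightarrow> ('s \<Rightarrow> data) \<Rightarrow> 'i set \<Rightarrow> ('i \<Rightarrow> 's \<Rightarrow> bool) \<Rightarrow> bool" where
  "poly_time_solvable enc_inst enc_sol Inst sol \<longleftrightarrow>
    (\<exists>(P :: prog) (p :: nat poly). \<forall>I\<in>Inst. \<exists>answer n.
       run P (enc_inst I) (enc_option enc_sol answer) n \<and>
       n + size (enc_option enc_sol answer) \<le> poly p (size (enc_inst I)) \<and>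
       (case answer of None \<Rightarrow> \<not> (\<exists>s. sol I s) | Some s \<Rightarrow> sol I s))"


section \<open>Tomography under window constraints\<close>

type_synonym point = "int \<times> int"

datatype comparison = Le | Eq | Ge

fun compares :: "comparison \<Rightarrow> nat \<Rightarrow> nat \<Rightarrow> bool" where
  "compares Le m k \<longleftrightarrow> m \<le> k"
| "compares Eq m k \<longleftrightarrow> m = k"
| "compares Ge m k \<longleftrightarrow> m \<ge> k"

text \<open>A window (a finite set of points, given by listing it) with its constraint.\<close>

record window =
  points :: "point list"
  comparison :: comparison
  bound :: nat

text \<open>
  The X-ray data functions have finite support and are given by their graphs on the support:
  a pair \<open>(y, n)\<close> in \<open>horizontal\<close> says that the line \<open>\<int> \<times> {y}\<close> contains \<open>n > 0\<close> points, a pair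
  \<open>(x, n)\<close> in \<open>vertical\<close> says the same of \<open>{x} \<times> \<int>\<close>; all other lines contain no point.
\<close>

record tomography =
  horizontal :: "(int \<times> nat) list"
  vertical :: "(int \<times> nat) list"
  windows :: "window list"

text \<open>The points \<open>g\<^sub>j\<close> of the candidate grid, in the order of the variables \<open>\<xi>\<^sub>j\<close>.\<close>

definition grid :: "tomography \<Rightarrow> point list" where
  "grid T = List.product (map fst (vertical T)) (map fst (horizontal T))"

definition window_indices :: "tomography \<Rightarrow> nat \<Rightarrow> nat set" where
  "window_indices T i = {j. j < length (grid T) \<and> grid T ! j \<in> set (points (windows T ! i))}"

definition valid_tomography :: "tomography \<Rightarrow> bool" where
  "valid_tomography T \<longleftrightarrow>
     distinct (map fst (horizontal T)) \<and> distinct (map fst (vertical T)) \<and>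
     (\<forall>(y, n)\<in>set (horizontal T). n > 0) \<and> (\<forall>(x, n)\<in>set (vertical T). n > 0) \<and>
     (\<forall>W\<in>set (windows T). points W \<noteq> [] \<and> distinct (points W) \<and> set (points W) \<subseteq> set (grid T))"

text \<open>The constraints \<open>A x = b\<close>, written out line by line.\<close>

definition xray_constraints :: "tomography \<Rightarrow> nat list \<Rightarrow> bool" where
  "xray_constraints T x \<longleftrightarrow>
     (\<forall>(c, n)\<in>set (horizontal T). (\<Sum>j | j < length (grid T) \<and> snd (grid T ! j) = c. x ! j) = n) \<and>
     (\<forall>(c, n)\<in>set (vertical T). (\<Sum>j | j < length (grid T) \<and> fst (grid T ! j) = c. x ! j) = n)"

definition window_constraints :: "tomography \<Rightarrow> nat list \<Rightarrow> bool" where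
  "window_constraints T x \<longleftrightarrow>
     (\<forall>i < length (windows T).
        compares (comparison (windows T ! i)) (\<Sum>j\<in>window_indices T i. x ! j) (bound (windows T ! i)))"

definition ilp_solution :: "tomography \<Rightarrow> nat list \<Rightarrow> bool" where
  "ilp_solution T x \<longleftrightarrow>
     length x = length (grid T) \<and> set x \<subseteq> {0, 1} \<and> xray_constraints T x \<and> window_constraints T x"

text \<open>An instance lists the data for the time steps \<open>\<tau> = 0, \<dots>, t - 1\<close>.\<close>

type_synonym inst = "tomography list"

definition valid_instance :: "inst \<Rightarrow> bool" where
  "valid_instance I \<longleftrightarrow> (\<forall>T\<in>set I. valid_tomography T)"

definition solution :: "inst \<Rightarrow> nat list list \<Rightarrow> bool" where
  "solution I xs \<longleftrightarrow> length xs = length I \<and> (\<forall>\<tau> < length I. ilp_solution (I ! \<tau>) (xs ! \<tau>))"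

text \<open>
  The properties of the windows. Windows lie in \<open>\<int> \<times> {p}\<close> or \<open>{p} \<times> \<int>\<close> where \<open>p\<close> is the
  respective coordinate of a point of the grid.
\<close>

definition windows_in_lines :: "inst \<Rightarrow> bool" where
  "windows_in_lines I \<longleftrightarrow>
     (\<forall>\<tau> < length I. \<forall>i < length (windows (I ! \<tau>)). \<exists>p\<in>set (grid (I ! \<tau>)).
        set (points (windows (I ! \<tau>) ! i)) \<subseteq> UNIV \<times> {snd p} \<or>
        set (points (windows (I ! \<tau>) ! i)) \<subseteq> {fst p} \<times> UNIV)"

definition windows_disjoint :: "inst \<Rightarrow> bool" where
  "windows_disjoint I \<longleftrightarrow>
     (\<forall>\<tau> < length I. \<forall>i < length (windows (I ! \<tau>)). \<forall>j < length (windows (I ! \<tau>)). i \<noteq> j \<longrightarrow>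
        set (points (windows (I ! \<tau>) ! i)) \<inter> set (points (windows (I ! \<tau>) ! j)) = {})"


section \<open>Encodings\<close>

text \<open>
  All numbers are encoded in binary, so that the size of an encoded instance is linear in its
  usual bit length.
\<close>

fun enc_list :: "('a \<Rightarrow> data) \<Rightarrow> 'a list \<Rightarrow> data" where
  "enc_list enc [] = Leaf"
| "enc_list enc (a # as) = Node (enc a) (enc_list enc as)"

fun enc_pair :: "('a \<Rightarrow> data) \<Rightarrow> ('b \<Rightarrow> data) \<Rightarrow> 'a \<times> 'b \<Rightarrow> data" where
  "enc_pair enc1 enc2 (a, b) = Node (enc1 a) (enc2 b)"

definition enc_bool :: "bool \<Rightarrow> data" where
  "enc_bool b = (if b then Node Leaf Leaf else Leaf)"

text \<open>Least significant bit first, without leading zeros.\<close>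

fun bits :: "nat \<Rightarrow> bool list" where
  "bits n = (if n = 0 then [] else odd n # bits (n div 2))"

declare bits.simps [simp del]

definition enc_nat :: "nat \<Rightarrow> data" where
  "enc_nat n = enc_list enc_bool (bits n)"

definition enc_int :: "int \<Rightarrow> data" where
  "enc_int z = Node (enc_bool (z < 0)) (enc_nat (nat \<bar>z\<bar>))"

fun enc_comparison :: "comparison \<Rightarrow> data" where
  "enc_comparison Le = Leaf"
| "enc_comparison Eq = Node Leaf Leaf"
| "enc_comparison Ge = Node (Node Leaf Leaf) Leaf"

definition enc_window :: "window \<Rightarrow> data" where
  "enc_window W = Node (enc_list (enc_pair enc_int enc_int) (points W))
     (Node (enc_comparison (comparison W)) (enc_nat (bound W)))"

definition enc_tomography :: "tomography \<Rightarrow> data" where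
  "enc_tomography T = Node (enc_list (enc_pair enc_int enc_nat) (horizontal T))
     (Node (enc_list (enc_pair enc_int enc_nat) (vertical T)) (enc_list enc_window (windows T)))"

definition enc_instance :: "inst \<Rightarrow> data" where
  "enc_instance = enc_list enc_tomography"

definition enc_solution :: "nat list list \<Rightarrow> data" where
  "enc_solution = enc_list (enc_list enc_nat)"

end

(*
  Truncating all numbers at the size of the grid loses nothing, so the X-ray and window constraints
  of one time step ask for an integral flow in a network of polynomial size: supplies at the rows,
  demands at the columns, and a unit arc from row to column for every point of the grid. As each
  point lies in at most one window and each window in one line, a window becomes a vertex that is
  put between its line and its points, joined to the line by arcs with lower and upper bounds.

  Flows with unit arcs are orientations of a multigraph with prescribed outdegrees. Those are found
  by adding the edges one after the other: a vertex with one edge too many passes it on along a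
  directed path to a vertex that still lacks one, and if none can be reached, then the set of
  reached vertices owns more edges, in every orientation, than it is allowed to.

  Running times are handled by closure properties of the functions that are computable in
  polynomial time; recursion over a list is admitted if all its intermediate results have
  polynomial size. The orientation algorithm stores with every reached vertex the whole orientation
  in which that vertex has received the surplus edge, so that paths need not be represented.
*)

theory Submission
  imports Defs
begin

section \<open>A calculus of polynomial-time functions\<close>

text \<open>Time and size bounds are claimed for every value of the input type, not only for
  admissible instances; this lets \<open>polytime\<close> compose without side conditions. The size
  bounds must then come from facts about arbitrary data, for instance that reversing an edge keeps
  its encoded size, while nonemptiness, disjointness and the line condition enter only through the
  locale \<open>tomography_in_lines\<close>. The obstacle to closure under recursion is that a
  single step may double its argument, and sharing makes doubling cheap in time. Hence the size of
  results is tracked next to time, and list recursion asks for a bound on the value at every suffix.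
  Disjointness is used twice in the reduction: it lets a window be named by its point list, and it
  leaves at most one end of a cell to a window, so that a cell remains a single unit arc with two
  different ends and its reversal can be recognised. Window constraints become bounds on one arc
  each because conservation at the window vertex forces that arc to carry the number of selected
  points.\<close>

text \<open>Coefficients in \<open>nat\<close> cannot be negative, so every such polynomial is
  monotone; this is how size bounds are composed.\<close>

lemma poly_nat_mono: "m \<le> n \<Longrightarrow> poly (p :: nat poly) m \<le> poly p n"
  by (induction p) (auto intro!: add_mono mult_mono)

text \<open>Relocation for linking: once \<open>k\<close> functions are put in front of a program,
  its calls have to point \<open>k\<close> places further.\<close>

fun shift :: "nat \<Rightarrow> expr \<Rightarrow> expr" where
  "shift k (Arg i) = Arg i"
| "shift k Lf = Lf"
| "shift k (Nd a b) = Nd (shift k a) (shift k b)"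
| "shift k (Left a) = Left (shift k a)"
| "shift k (Right a) = Right (shift k a)"
| "shift k (If a b c) = If (shift k a) (shift k b) (shift k c)"
| "shift k (Call f es) = Call (k + f) (map (shift k) es)"

lemma eval_link:
  "eval P env e v n \<Longrightarrow> eval (Q @ map (shift (length Q)) P @ R) env (shift (length Q) e) v n"
  and evals_link:
  "evals P env es vs n \<Longrightarrow>
    evals (Q @ map (shift (length Q)) P @ R) env (map (shift (length Q)) es) vs n"
proof (induction rule: eval_evals.inducts)
  case (Call f env es vs m v n)
  then have "eval (Q @ map (shift (length Q)) P @ R) vs
      ((Q @ map (shift (length Q)) P @ R) ! (length Q + f)) v n"
    by (simp add: nth_append)
  moreover have "length Q + f < length (Q @ map (shift (length Q)) P @ R)"
    using Call(1) by simp
  ultimately show ?case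
    unfolding shift.simps using Call(3) by (blast intro: eval_evals.Call)
qed (auto intro: eval_evals.intros simp del: One_nat_def)

text \<open>Size is bounded along with time: sharing can make a result exponentially larger than the
  number of steps, and a later program pays for that size.\<close>

definition implements :: "prog \<Rightarrow> nat \<Rightarrow> nat poly \<Rightarrow> ('a \<Rightarrow> data) \<Rightarrow> ('a \<Rightarrow> data) \<Rightarrow> bool" where
  "implements P i p e f \<longleftrightarrow>
    (\<forall>x. \<exists>n. i < length P \<and> eval P [e x] (P ! i) (f x) n \<and> n + size (f x) \<le> poly p (size (e x)))"

definition computable :: "('a \<Rightarrow> data) \<Rightarrow> ('a \<Rightarrow> data) \<Rightarrow> bool" where
  "computable e f \<longleftrightarrow> (\<exists>P p. implements P 0 p e f)"

lemma implements_link: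
  assumes "implements P 0 p e f"
  shows "implements (Q @ map (shift (length Q)) P @ R) (length Q) p e f"
  unfolding implements_def
proof
  fix x
  obtain n where n: "0 < length P" "eval P [e x] (P ! 0) (f x) n" "n + size (f x) \<le> poly p (size (e x))"
    using assms unfolding implements_def by blast
  moreover have "eval (Q @ map (shift (length Q)) P @ R) [e x]
      ((Q @ map (shift (length Q)) P @ R) ! length Q) (f x) n"
    using eval_link[OF n(2), of Q R] n(1) by (simp add: nth_append)
  ultimately show "\<exists>n. length Q < length (Q @ map (shift (length Q)) P @ R) \<and>
      eval (Q @ map (shift (length Q)) P @ R) [e x]
        ((Q @ map (shift (length Q)) P @ R) ! length Q) (f x) n \<and>
      n + size (f x) \<le> poly p (size (e x))"
    by auto
qed

lemma eval_Call:
  assumes "implements P i p e f" "eval P env a (e x) m"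
  obtains n where "eval P env (Call i [a]) (f x) (1 + (m + 0) + n)" "n \<le> poly p (size (e x))"
proof -
  obtain n where "i < length P" "eval P [e x] (P ! i) (f x) n" "n + size (f x) \<le> poly p (size (e x))"
    using assms(1) unfolding implements_def by blast
  with that show ?thesis
    using assms(2) by (meson Args Call Empty add_leD1)
qed

lemma size_implements: "implements P i p e f \<Longrightarrow> size (f x) \<le> poly p (size (e x))"
  unfolding implements_def by (meson add_leD2)

lemma eval_Arg_0: "eval P (d # env) (Arg 0) d 1"
  using Arg[of 0 "d # env"] by simp

lemma computable_comp:
  assumes "computable e1 e2" "computable e2 f"
  shows "computable e1 f"
proof -
  obtain P p Q q where P: "implements P 0 p e1 e2" and Q: "implements Q 0 q e2 f"
    using assms unfolding computable_def by blast
  define C where "C = Call (1 + length P) [Call 1 [Arg 0]]"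
  define R where "R = [C] @ map (shift 1) P @ map (shift (1 + length P)) Q"
  have p: "implements R 1 p e1 e2"
    using implements_link[OF P, of "[C]"] by (simp add: R_def)
  have q: "implements R (1 + length P) q e2 f"
    using implements_link[OF Q, of "[C] @ map (shift 1) P" "[]"] by (simp add: R_def)
  \<comment> \<open>The 3 counts two calls and one argument; \<open>pcompose q p\<close> enters
    twice, for the time of the second program and for the size of its result.\<close>
  have "implements R 0 (3 + p + 2 * pcompose q p) e1 f"
    unfolding implements_def
  proof
    fix x
    from eval_Call[OF p eval_Arg_0] obtain m where
      m: "eval R [e1 x] (Call 1 [Arg 0]) (e2 x) (1 + (1 + 0) + m)" "m \<le> poly p (size (e1 x))" .
    from eval_Call[OF q m(1)] obtain n where
      n: "eval R [e1 x] C (f x) (1 + (1 + (1 + 0) + m + 0) + n)" "n \<le> poly q (size (e2 x))"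
      unfolding C_def by blast
    have s: "poly q (size (e2 x)) \<le> poly q (poly p (size (e1 x)))"
      by (rule poly_nat_mono[OF size_implements[OF p]])
    have "1 + (1 + (1 + 0) + m + 0) + n + size (f x) \<le> poly (3 + p + 2 * pcompose q p) (size (e1 x))"
      using m(2) n(2) s size_implements[OF q, of x] by (simp add: poly_pcompose)
    moreover have "R ! 0 = C" "0 < length R" by (simp_all add: R_def)
    ultimately show "\<exists>n. 0 < length R \<and> eval R [e1 x] (R ! 0) (f x) n \<and>
        n + size (f x) \<le> poly (3 + p + 2 * pcompose q p) (size (e1 x))"
      using n(1) by metis
  qed
  then show ?thesis unfolding computable_def by blast
qed

lemma computable_Node:
  assumes "computable e f" "computable e g"
  shows "computable e (\<lambda>x. Node (f x) (g x))"
proof -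
  obtain P p Q q where P: "implements P 0 p e f" and Q: "implements Q 0 q e g"
    using assms unfolding computable_def by blast
  define C where "C = Nd (Call 1 [Arg 0]) (Call (1 + length P) [Arg 0])"
  define R where "R = [C] @ map (shift 1) P @ map (shift (1 + length P)) Q"
  have p: "implements R 1 p e f"
    using implements_link[OF P, of "[C]"] by (simp add: R_def)
  have q: "implements R (1 + length P) q e g"
    using implements_link[OF Q, of "[C] @ map (shift 1) P" "[]"] by (simp add: R_def)
  have "implements R 0 (6 + 2 * p + 2 * q) e (\<lambda>x. Node (f x) (g x))"
    unfolding implements_def
  proof
    fix x
    have a: "eval R [e x] (Arg 0) (e x) 1"
      by (rule eval_Arg_0)
    from eval_Call[OF p a] obtain m where
      m: "eval R [e x] (Call 1 [Arg 0]) (f x) (1 + (1 + 0) + m)" "m \<le> poly p (size (e x))" .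
    from eval_Call[OF q a] obtain n where
      n: "eval R [e x] (Call (1 + length P) [Arg 0]) (g x) (1 + (1 + 0) + n)"
        "n \<le> poly q (size (e x))" .
    have "eval R [e x] C (Node (f x) (g x)) (1 + (1 + (1 + 0) + m) + (1 + (1 + 0) + n))"
      unfolding C_def by (rule Nd[OF m(1) n(1)])
    moreover have "1 + (1 + (1 + 0) + m) + (1 + (1 + 0) + n) + size (Node (f x) (g x))
        \<le> poly (6 + 2 * p + 2 * q) (size (e x))"
      using m(2) n(2) size_implements[OF p, of x] size_implements[OF q, of x] by simp
    moreover have "R ! 0 = C" "0 < length R" by (simp_all add: R_def)
    ultimately show "\<exists>n. 0 < length R \<and> eval R [e x] (R ! 0) (Node (f x) (g x)) n \<and>
        n + size (Node (f x) (g x)) \<le> poly (6 + 2 * p + 2 * q) (size (e x))"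
      by metis
  qed
  then show ?thesis unfolding computable_def by blast
qed

lemma size_left: "size (left d) \<le> size d" and size_right: "size (right d) \<le> size d"
  by (cases d; simp)+

lemma computable_expr:
  assumes "\<And>x. \<exists>n \<le> k. eval [C] [e x] C (f x) n" "\<And>x. size (f x) \<le> size (e x)"
  shows "computable e f"
proof -
  have "implements [C] 0 [:k, 1:] e f"
    unfolding implements_def
  proof
    fix x
    obtain n where "n \<le> k" "eval [C] [e x] C (f x) n"
      using assms(1) by blast
    then show "\<exists>n. 0 < length [C] \<and> eval [C] [e x] ([C] ! 0) (f x) n \<and>
        n + size (f x) \<le> poly [:k, 1:] (size (e x))"
      using assms(2)[of x] by (intro exI[of _ n]) simp
  qed
  then show ?thesis unfolding computable_def by blast
qed

lemma computable_refl: "computable e e"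
  by (rule computable_expr[of 1 "Arg 0"]) (use eval_Arg_0 in blast, simp)

lemma computable_left:
  assumes "computable e f"
  shows "computable e (\<lambda>x. left (f x))"
proof (rule computable_comp[OF assms], rule computable_expr[of 2 "Left (Arg 0)"])
  show "\<exists>n \<le> 2. eval [Left (Arg 0)] [f x] (Left (Arg 0)) (left (f x)) n" for x
    using Left[OF eval_Arg_0] by (metis nat_1_add_1 order_refl)
qed (rule size_left)

lemma computable_right:
  assumes "computable e f"
  shows "computable e (\<lambda>x. right (f x))"
proof (rule computable_comp[OF assms], rule computable_expr[of 2 "Right (Arg 0)"])
  show "\<exists>n \<le> 2. eval [Right (Arg 0)] [f x] (Right (Arg 0)) (right (f x)) n" for x
    using Right[OF eval_Arg_0] by (metis nat_1_add_1 order_refl)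
qed (rule size_right)

text \<open>Both branches are computed before the test picks one. This is harmless as each is
  polynomial, and it reduces the conditional to a fixed expression on a triple.\<close>

lemma computable_if:
  assumes "computable e b" "computable e f" "computable e g"
  shows "computable e (\<lambda>x. if b x = Leaf then g x else f x)"
proof (rule computable_comp)
  show "computable e (\<lambda>x. Node (b x) (Node (f x) (g x)))"
    using assms by (intro computable_Node)
  let ?C = "If (Left (Arg 0)) (Left (Right (Arg 0))) (Right (Right (Arg 0)))"
  show "computable (\<lambda>x. Node (b x) (Node (f x) (g x))) (\<lambda>x. if b x = Leaf then g x else f x)"
  proof (rule computable_expr[of 6 ?C])
    fix x
    let ?d = "Node (b x) (Node (f x) (g x))"
    have a: "eval [?C] [?d] (Arg 0) ?d 1"
      by (rule eval_Arg_0)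
    have "eval [?C] [?d] (Left (Arg 0)) (b x) 2" "eval [?C] [?d] (Left (Right (Arg 0))) (f x) 3"
      "eval [?C] [?d] (Right (Right (Arg 0))) (g x) 3"
      using Left[OF a] Left[OF Right[OF a]] Right[OF Right[OF a]]
      by (simp_all add: numeral_2_eq_2 numeral_3_eq_3)
    note e = this
    have "eval [?C] [?d] ?C (if b x = Leaf then g x else f x) (1 + 2 + 3)"
    proof (cases "b x = Leaf")
      case True
      then have "eval [?C] [?d] (Left (Arg 0)) Leaf 2" using e(1) by simp
      from IfLeaf[OF this e(3), of "Left (Right (Arg 0))"] show ?thesis using True by simp
    next
      case False
      from IfNode[OF e(1) False e(2)] False show ?thesis by simp
    qed
    moreover have "1 + 2 + 3 \<le> (6 :: nat)" by simp
    ultimately show "\<exists>n \<le> 6. eval [?C] [?d] ?C (if b x = Leaf then g x else f x) n"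
      by blast
  qed auto
qed

lemma computable_const: "computable e (\<lambda>_. d)"
proof (induction d)
  case Leaf
  show ?case
    by (rule computable_expr[of 1 Lf]) (use Lf in force, simp)
next
  case (Node d1 d2)
  then show ?case by (rule computable_Node)
qed


section \<open>Evaluation with upper bounds on the number of steps\<close>

definition eval_within :: "prog \<Rightarrow> data list \<Rightarrow> expr \<Rightarrow> data \<Rightarrow> nat \<Rightarrow> bool" where
  "eval_within P env e v N \<longleftrightarrow> (\<exists>n \<le> N. eval P env e v n)"

lemma within_mono: "eval_within P env e v M \<Longrightarrow> M \<le> N \<Longrightarrow> eval_within P env e v N"
  unfolding eval_within_def using order_trans by blast

lemma within_Arg: "i < length env \<Longrightarrow> eval_within P env (Arg i) (env ! i) 1"
  unfolding eval_within_def using Arg by blast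

lemma within_Lf: "eval_within P env Lf Leaf 1"
  unfolding eval_within_def using Lf by blast

lemma within_Nd:
  "eval_within P env a u m \<Longrightarrow> eval_within P env b v n \<Longrightarrow>
    eval_within P env (Nd a b) (Node u v) (1 + m + n)"
  unfolding eval_within_def by (meson Nd add_le_mono order_refl)

lemma within_Left: "eval_within P env a u m \<Longrightarrow> eval_within P env (Left a) (left u) (1 + m)"
  unfolding eval_within_def by (meson Left add_le_mono order_refl)

lemma within_Right: "eval_within P env a u m \<Longrightarrow> eval_within P env (Right a) (right u) (1 + m)"
  unfolding eval_within_def by (meson Right add_le_mono order_refl)

lemma within_IfNode:
  "eval_within P env b u m \<Longrightarrow> u \<noteq> Leaf \<Longrightarrow> eval_within P env e1 v n \<Longrightarrow>
    eval_within P env (If b e1 e2) v (1 + m + n)"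
  unfolding eval_within_def by (meson IfNode add_le_mono order_refl)

lemma within_IfLeaf:
  "eval_within P env b Leaf m \<Longrightarrow> eval_within P env e2 v n \<Longrightarrow>
    eval_within P env (If b e1 e2) v (1 + m + n)"
  unfolding eval_within_def by (meson IfLeaf add_le_mono order_refl)

lemma within_Call1:
  assumes "f < length P" "eval_within P env a u m" "eval_within P [u] (P ! f) v n"
  shows "eval_within P env (Call f [a]) v (1 + m + n)"
proof -
  obtain m' n' where "m' \<le> m" "eval P env a u m'" "n' \<le> n" "eval P [u] (P ! f) v n'"
    using assms unfolding eval_within_def by blast
  then have "eval P env (Call f [a]) v (1 + (m' + 0) + n')"
    using assms(1) by (blast intro: Call Args Empty)
  with \<open>m' \<le> m\<close> \<open>n' \<le> n\<close> show ?thesis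
    unfolding eval_within_def by (intro exI[of _ "1 + (m' + 0) + n'"]) simp
qed

lemma within_Call2:
  assumes "f < length P" "eval_within P env a u k" "eval_within P env b v m"
    "eval_within P [u, v] (P ! f) w n"
  shows "eval_within P env (Call f [a, b]) w (1 + (k + m) + n)"
proof -
  obtain k' m' n' where "k' \<le> k" "eval P env a u k'" "m' \<le> m" "eval P env b v m'"
    "n' \<le> n" "eval P [u, v] (P ! f) w n'"
    using assms unfolding eval_within_def by blast
  moreover from this have "eval P env (Call f [a, b]) w (1 + (k' + (m' + 0)) + n')"
    using assms(1) by (blast intro: Call Args Empty)
  ultimately show ?thesis
    unfolding eval_within_def by (intro exI[of _ "1 + (k' + (m' + 0)) + n'"]) simp
qed

lemma within_Call3:
  assumes "f < length P" "eval_within P env a u k" "eval_within P env b v l" "eval_within P env c w m"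
    "eval_within P [u, v, w] (P ! f) z n"
  shows "eval_within P env (Call f [a, b, c]) z (1 + (k + l + m) + n)"
proof -
  obtain k' l' m' n' where "k' \<le> k" "eval P env a u k'" "l' \<le> l" "eval P env b v l'"
    "m' \<le> m" "eval P env c w m'" "n' \<le> n" "eval P [u, v, w] (P ! f) z n'"
    using assms unfolding eval_within_def by blast
  moreover from this have "eval P env (Call f [a, b, c]) z (1 + (k' + (l' + (m' + 0))) + n')"
    using assms(1) by (blast intro: Call Args Empty)
  ultimately show ?thesis
    unfolding eval_within_def by (intro exI[of _ "1 + (k' + (l' + (m' + 0))) + n'"]) simp
qed

lemma within_implements:
  "implements P i p e f \<Longrightarrow> i < length P \<and> eval_within P [e x] (P ! i) (f x) (poly p (size (e x)))"
  unfolding implements_def eval_within_def by (meson add_leD1)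

lemma implements_within:
  assumes "i < length P" "\<And>x. eval_within P [e x] (P ! i) (f x) (poly p (size (e x)))"
    "\<And>x. size (f x) \<le> poly q (size (e x))"
  shows "implements P i (p + q) e f"
  using assms unfolding implements_def eval_within_def poly_add by (meson add_le_mono)

lemma within_Arg_left: "i < length env \<Longrightarrow> eval_within P env (Left (Arg i)) (left (env ! i)) 2"
  using within_Left[OF within_Arg] by (simp add: numeral_2_eq_2)

lemma within_Arg_right: "i < length env \<Longrightarrow> eval_within P env (Right (Arg i)) (right (env ! i)) 2"
  using within_Right[OF within_Arg] by (simp add: numeral_2_eq_2)

section \<open>Equality of trees by simultaneous descent\<close>

definition equality_program :: prog where
  "equality_program =
    [Call 1 [Left (Arg 0), Right (Arg 0)],
     If (Arg 0)
       (If (Arg 1)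
         (If (Call 1 [Left (Arg 0), Left (Arg 1)]) (Call 1 [Right (Arg 0), Right (Arg 1)]) Lf)
         Lf)
       (If (Arg 1) Lf (Nd Lf Lf))]"

lemma equality_program_nth:
  "equality_program ! 0 = Call 1 [Left (Arg 0), Right (Arg 0)]"
  "equality_program ! 1 = If (Arg 0)
     (If (Arg 1)
       (If (Call 1 [Left (Arg 0), Left (Arg 1)]) (Call 1 [Right (Arg 0), Right (Arg 1)]) Lf)
       Lf)
     (If (Arg 1) Lf (Nd Lf Lf))"
  by (simp_all add: equality_program_def)

text \<open>The first tree alone bounds the descent, since a \<open>Leaf\<close> on either side
  stops it. At a node both recursive calls bring their constant 10; these and the administrative
  steps are covered by the 40 for the node.\<close>

lemma equality_program:
  "eval_within equality_program [a, b] (equality_program ! 1) (enc_bool (a = b)) (40 * size a + 10)"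
proof (induction a arbitrary: b)
  case Leaf
  let ?P = equality_program
  have 0: "eval_within ?P [Leaf, b] (Arg 0) Leaf 1"
    using within_Arg[of 0 "[Leaf, b]"] by simp
  have 1: "eval_within ?P [Leaf, b] (Arg 1) b 1"
    using within_Arg[of 1 "[Leaf, b]"] by simp
  have "eval_within ?P [Leaf, b] (If (Arg 1) Lf (Nd Lf Lf)) (enc_bool (Leaf = b)) 5"
  proof (cases b)
    case Leaf
    with within_IfLeaf[OF _ within_Nd[OF within_Lf within_Lf]] 1 show ?thesis
      by (fastforce intro: within_mono simp: enc_bool_def)
  next
    case (Node l r)
    with within_IfNode[OF 1 _ within_Lf] show ?thesis
      by (fastforce intro: within_mono simp: enc_bool_def)
  qed
  from within_IfLeaf[OF 0 this] show ?case
    unfolding equality_program_nth by (rule within_mono) simp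
next
  case (Node l r)
  let ?P = equality_program and ?env = "[Node l r, b]"
  have 0: "eval_within ?P ?env (Arg 0) (Node l r) 1"
    using within_Arg[of 0 ?env] by simp
  have 1: "eval_within ?P ?env (Arg 1) b 1"
    using within_Arg[of 1 ?env] by simp
  show ?case
  proof (cases b)
    case Leaf
    have "eval_within ?P ?env (If (Arg 1) e Lf) (enc_bool (Node l r = b)) (1 + 1 + 1)" for e
      using within_IfLeaf[OF 1[unfolded Leaf] within_Lf] Leaf by (simp add: enc_bool_def)
    from within_IfNode[OF 0 _ this] show ?thesis
      unfolding equality_program_nth by (rule within_mono) simp_all
  next
    case b: (Node l' r')
    have len: "1 < length ?P"
      by (simp add: equality_program_def)
    have L: "eval_within ?P ?env (Call 1 [Left (Arg 0), Left (Arg 1)]) (enc_bool (l = l'))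
        (1 + (2 + 2) + (40 * size l + 10))"
      by (rule within_Call2[OF len _ _ Node.IH(1)])
        (use within_Arg_left[of 0 ?env] within_Arg_left[of 1 ?env] b in simp_all)
    have R: "eval_within ?P ?env (Call 1 [Right (Arg 0), Right (Arg 1)]) (enc_bool (r = r'))
        (1 + (2 + 2) + (40 * size r + 10))"
      by (rule within_Call2[OF len _ _ Node.IH(2)])
        (use within_Arg_right[of 0 ?env] within_Arg_right[of 1 ?env] b in simp_all)
    have "eval_within ?P ?env
        (If (Call 1 [Left (Arg 0), Left (Arg 1)]) (Call 1 [Right (Arg 0), Right (Arg 1)]) Lf)
        (enc_bool (Node l r = b)) (1 + (1 + (2 + 2) + (40 * size l + 10)) + (1 + (2 + 2) + (40 * size r + 10)))"
    proof (cases "l = l'")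
      case True
      with within_IfNode[OF L _ R] b show ?thesis by (simp add: enc_bool_def)
    next
      case False
      with L have e: "eval_within ?P ?env (Call 1 [Left (Arg 0), Left (Arg 1)]) Leaf
          (1 + (2 + 2) + (40 * size l + 10))"
        by (simp add: enc_bool_def)
      from False b have "enc_bool (Node l r = b) = Leaf"
        by (simp add: enc_bool_def)
      then show ?thesis
        by (simp only:) (rule within_mono[OF within_IfLeaf[OF e within_Lf]], simp)
    qed
    from within_IfNode[OF 0 _ within_IfNode[OF 1 _ this]] show ?thesis
      unfolding equality_program_nth by (rule within_mono) (simp_all add: b)
  qed
qed

lemma computable_eq: "computable (\<lambda>(a, b). Node a b) (\<lambda>(a, b). enc_bool (a = b))"
proof -
  let ?e = "\<lambda>(a, b). Node a b" and ?f = "\<lambda>(a, b). enc_bool (a = b)"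
  have "implements equality_program 0 ([:15, 40:] + [:1:]) ?e ?f"
  proof (rule implements_within)
    show "0 < length equality_program" by (simp add: equality_program_def)
    fix x :: "data \<times> data"
    obtain a b where x: "x = (a, b)" by force
    let ?P = equality_program and ?env = "[Node a b]"
    have "eval_within ?P ?env (Call 1 [Left (Arg 0), Right (Arg 0)]) (enc_bool (a = b))
        (1 + (2 + 2) + (40 * size a + 10))"
      by (rule within_Call2[OF _ _ _ equality_program])
        (use within_Arg_left[of 0 ?env] within_Arg_right[of 0 ?env] in
          \<open>simp_all add: equality_program_def\<close>)
    then show "eval_within ?P [?e x] (?P ! 0) (?f x) (poly [:15, 40:] (size (?e x)))"
      unfolding equality_program_nth x prod.case by (rule within_mono) simp
    show "size (?f x) \<le> poly [:1:] (size (?e x))"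
      by (auto simp: x enc_bool_def)
  qed
  then show ?thesis unfolding computable_def by blast
qed

section \<open>Primitive recursion over lists\<close>

lemma length_le_size_enc_list: "length xs \<le> size (enc_list e xs)"
  by (induction xs) auto

lemma size_enc_list_append: "size (enc_list e (xs @ ys)) = size (enc_list e xs) + size (enc_list e ys)"
  by (induction xs) auto

text \<open>The step sees the tail beside its recursive value, as \<open>remove1\<close> requires,
  where the answer may be the tail itself. Recursion visits just the suffixes of \<open>L x\<close>,
  so the bound is asked for these only; it cannot be derived, because a step that doubles its
  argument is itself polynomial.\<close>

lemma computable_rec_list_aux:
  fixes L :: "'c \<Rightarrow> 'a list" and i :: "'c \<Rightarrow> 'b" and g :: "'c \<Rightarrow> 'a \<Rightarrow> 'a list \<Rightarrow> 'b \<Rightarrow> 'b"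
  assumes g: "computable (\<lambda>(a, as, b, x). Node (ea a) (Node (enc_list ea as) (Node (eb b) (ec x))))
      (\<lambda>(a, as, b, x). eb (g x a as b))"
    and bound: "\<And>x us zs. L x = us @ zs \<Longrightarrow>
      size (eb (rec_list (i x) (g x) zs)) \<le> poly q (size (ec x))"
  shows "computable (\<lambda>x. Node (enc_list ea (L x)) (Node (eb (i x)) (ec x)))
    (\<lambda>x. eb (rec_list (i x) (g x) (L x)))"
proof -
  let ?e = "\<lambda>(a, as, b, x). Node (ea a) (Node (enc_list ea as) (Node (eb b) (ec x)))"
  let ?f = "\<lambda>x. rec_list (i x) (g x)"
  let ?e' = "\<lambda>x. Node (enc_list ea (L x)) (Node (eb (i x)) (ec x))"
  obtain P p where P: "implements P 0 p ?e (\<lambda>(a, as, b, x). eb (g x a as b))"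
    using g unfolding computable_def by blast
  define C0 where "C0 = Call 1 [Left (Arg 0), Left (Right (Arg 0)), Right (Right (Arg 0))]"
  define B where "B = Nd (Left (Arg 0)) (Nd (Right (Arg 0))
    (Nd (Call 1 [Right (Arg 0), Arg 1, Arg 2]) (Arg 2)))"
  define C1 where "C1 = If (Arg 0) (Call 2 [B]) (Arg 1)"
  define R where "R = [C0, C1] @ map (shift 2) P"
  have R: "R ! 0 = C0" "R ! 1 = C1" "2 \<le> length R"
    by (simp_all add: R_def)
  have G: "implements R 2 p ?e (\<lambda>(a, as, b, x). eb (g x a as b))"
    using implements_link[OF P, of "[C0, C1]" "[]"] by (simp add: R_def numeral_2_eq_2)
  \<comment> \<open>Bounds the time of one step uniformly in the suffix: twice the input dominates
    head, tail and context, and \<open>q\<close> the recursive value.\<close>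
  define S where "S x = poly p (3 + 2 * size (?e' x) + poly q (size (ec x)))" for x
  have step: "eval_within R [enc_list ea zs, eb (i x), ec x] C1 (eb (?f x zs))
      ((length zs + 1) * (20 + S x))" if "L x = us @ zs" for x us zs
    using that
  proof (induction zs arbitrary: us)
    case Nil
    let ?env = "[Leaf, eb (i x), ec x]"
    have "eval_within R ?env (Arg 0) Leaf 1" "eval_within R ?env (Arg 1) (eb (i x)) 1"
      using within_Arg[of 0 ?env] within_Arg[of 1 ?env] by simp_all
    from within_mono[OF within_IfLeaf[OF this, of "Call 2 [B]"]] show ?case
      unfolding C1_def by simp
  next
    case (Cons a zs)
    let ?env = "[enc_list ea (a # zs), eb (i x), ec x]"
    let ?T = "(length zs + 1) * (20 + S x)"
    have A: "eval_within R ?env (Arg 0) (Node (ea a) (enc_list ea zs)) 1"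
      "eval_within R ?env (Arg 1) (eb (i x)) 1" "eval_within R ?env (Arg 2) (ec x) 1"
      using within_Arg[of 0 ?env] within_Arg[of 1 ?env] within_Arg[of 2 ?env] by simp_all
    have IH: "eval_within R [enc_list ea zs, eb (i x), ec x] (R ! 1) (eb (?f x zs)) ?T"
      unfolding R by (rule Cons.IH[of "us @ [a]"]) (simp add: Cons.prems)
    have "eval_within R ?env (Call 1 [Right (Arg 0), Arg 1, Arg 2]) (eb (?f x zs))
        (1 + (2 + 1 + 1) + ?T)"
      by (rule within_Call3[OF _ _ A(2) A(3) IH])
        (use R(3) within_Arg_right[of 0 ?env] in simp_all)
    from within_Nd[OF within_Arg_left[of 0 ?env]
        within_Nd[OF within_Arg_right[of 0 ?env] within_Nd[OF this A(3)]]]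
    have B: "eval_within R ?env B (?e (a, zs, ?f x zs, x)) (13 + ?T)"
      unfolding B_def by simp
    have "size (?e (a, zs, ?f x zs, x)) \<le> 3 + 2 * size (?e' x) + poly q (size (ec x))"
      using bound[of x "us @ [a]" zs] Cons.prems by (simp add: size_enc_list_append)
    then have S: "poly p (size (?e (a, zs, ?f x zs, x))) \<le> S x"
      unfolding S_def by (rule poly_nat_mono)
    have "eval_within R [?e (a, zs, ?f x zs, x)] (R ! 2) (eb (?f x (a # zs))) (S x)"
      using within_implements[OF G, of "(a, zs, ?f x zs, x)"] S
      by (auto intro: within_mono)
    from within_Call1[OF _ B this] have "eval_within R ?env (Call 2 [B]) (eb (?f x (a # zs)))
        (1 + (13 + ?T) + S x)"
      using within_implements[OF G] by blast
    from within_IfNode[OF A(1) _ this] show ?case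
      unfolding C1_def by (rule within_mono) simp_all
  qed
  have "implements R 0 ([:10:] + [:1, 1:] * ([:20:] + pcompose p ([:3, 2:] + q)) + q) ?e'
      (\<lambda>x. eb (?f x (L x)))"
  proof (rule implements_within)
    show "0 < length R" by (simp add: R_def)
    fix x
    let ?env = "[?e' x]" and ?T = "(length (L x) + 1) * (20 + S x)"
    have A: "eval_within R ?env (Arg 0) (?e' x) 1"
      using within_Arg[of 0 ?env] by simp
    have q: "poly q (size (ec x)) \<le> poly q (size (?e' x))"
      by (rule poly_nat_mono) simp
    have S: "S x \<le> poly (pcompose p ([:3, 2:] + q)) (size (?e' x))"
      unfolding S_def poly_pcompose by (rule poly_nat_mono) (use q in simp)
    have l: "length (L x) \<le> size (?e' x)"
      using length_le_size_enc_list[of "L x" ea] by simp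
    have T: "?T \<le> (1 + size (?e' x)) * (20 + poly (pcompose p ([:3, 2:] + q)) (size (?e' x)))"
      by (rule mult_mono) (use S l in simp_all)
    have "eval_within R ?env C0 (eb (?f x (L x))) (1 + (2 + 3 + 3) + ?T)"
      unfolding C0_def
    proof (rule within_Call3)
      show "1 < length R" using R by simp
      show "eval_within R ?env (Left (Arg 0)) (enc_list ea (L x)) 2"
        using within_Left[OF A] by (simp add: numeral_2_eq_2)
      show "eval_within R ?env (Left (Right (Arg 0))) (eb (i x)) 3"
        using within_Left[OF within_Right[OF A]] by (simp add: numeral_3_eq_3)
      show "eval_within R ?env (Right (Right (Arg 0))) (ec x) 3"
        using within_Right[OF within_Right[OF A]] by (simp add: numeral_3_eq_3)
      show "eval_within R [enc_list ea (L x), eb (i x), ec x] (R ! 1) (eb (?f x (L x))) ?T"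
        unfolding R using step[of x "[]"] by simp
    qed
    then show "eval_within R ?env (R ! 0) (eb (?f x (L x)))
        (poly ([:10:] + [:1, 1:] * ([:20:] + pcompose p ([:3, 2:] + q))) (size (?e' x)))"
      unfolding R by (rule within_mono) (use T in simp)
    show "size (eb (?f x (L x))) \<le> poly q (size (?e' x))"
      using bound[of x "[]" "L x"] q by simp
  qed
  then show ?thesis unfolding computable_def by blast
qed

lemma computable_rec_list:
  assumes "computable (\<lambda>(a, as, b, x). Node (ea a) (Node (enc_list ea as) (Node (eb b) (ec x))))
      (\<lambda>(a, as, b, x). eb (g x a as b))"
    and "\<And>x us zs. L x = us @ zs \<Longrightarrow> size (eb (rec_list (i x) (g x) zs)) \<le> poly q (size (ec x))"
    and "computable ec (\<lambda>x. enc_list ea (L x))" "computable ec (\<lambda>x. eb (i x))"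
  shows "computable ec (\<lambda>x. eb (rec_list (i x) (g x) (L x)))"
  by (rule computable_comp[OF _ computable_rec_list_aux[OF assms(1,2)]])
    (intro computable_Node assms(3,4) computable_refl)

section \<open>Closure properties for functions between encoded types\<close>

definition polytime :: "('a \<Rightarrow> data) \<Rightarrow> ('b \<Rightarrow> data) \<Rightarrow> ('a \<Rightarrow> 'b) \<Rightarrow> bool" where
  "polytime e1 e2 f \<longleftrightarrow> computable e1 (\<lambda>x. e2 (f x))"

named_theorems polytime_intros

lemma polytime_var [polytime_intros]: "polytime e e (\<lambda>x. x)"
  unfolding polytime_def by (rule computable_refl)

lemma polytime_const [polytime_intros]: "polytime e1 e2 (\<lambda>_. c)"
  unfolding polytime_def by (rule computable_const)

lemma polytime_comp:
  assumes "polytime e1 e2 f" "polytime e2 e3 g"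
  shows "polytime e1 e3 (\<lambda>x. g (f x))"
proof -
  obtain P p where "implements P 0 p e2 (\<lambda>x. e3 (g x))"
    using assms(2) unfolding polytime_def computable_def by blast
  then have "computable (\<lambda>x. e2 (f x)) (\<lambda>x. e3 (g (f x)))"
    unfolding implements_def computable_def by blast
  with assms(1) show ?thesis
    unfolding polytime_def by (rule computable_comp)
qed

lemma size_polytime:
  assumes "polytime e1 e2 f"
  obtains p where "\<And>x. size (e2 (f x)) \<le> poly p (size (e1 x))"
  using assms unfolding polytime_def computable_def by (metis size_implements)

lemma enc_pair_eq: "enc_pair e1 e2 p = Node (e1 (fst p)) (e2 (snd p))"
  by (cases p) simp

lemma polytime_Pair [polytime_intros]:
  "polytime ec e1 f \<Longrightarrow> polytime ec e2 g \<Longrightarrow> polytime ec (enc_pair e1 e2) (\<lambda>x. (f x, g x))"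
  unfolding polytime_def by (simp add: computable_Node)

lemma polytime_fst [polytime_intros]:
  "polytime ec (enc_pair e1 e2) f \<Longrightarrow> polytime ec e1 (\<lambda>x. fst (f x))"
  unfolding polytime_def enc_pair_eq by (drule computable_left) simp

lemma polytime_snd [polytime_intros]:
  "polytime ec (enc_pair e1 e2) f \<Longrightarrow> polytime ec e2 (\<lambda>x. snd (f x))"
  unfolding polytime_def enc_pair_eq by (drule computable_right) simp

lemma enc_bool_Leaf: "enc_bool b = Leaf \<longleftrightarrow> \<not> b"
  by (simp add: enc_bool_def)

lemma polytime_if [polytime_intros]:
  assumes "polytime ec enc_bool b" "polytime ec e f" "polytime ec e g"
  shows "polytime ec e (\<lambda>x. if b x then f x else g x)"
proof -
  have "(\<lambda>x. e (if b x then f x else g x)) = (\<lambda>x. if enc_bool (b x) = Leaf then e (g x) else e (f x))"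
    by (auto simp: enc_bool_Leaf)
  with computable_if[OF assms[unfolded polytime_def]] show ?thesis
    unfolding polytime_def by simp
qed

lemma polytime_not [polytime_intros]:
  "polytime ec enc_bool b \<Longrightarrow> polytime ec enc_bool (\<lambda>x. \<not> b x)"
  using polytime_if[of ec b enc_bool "\<lambda>_. False" "\<lambda>_. True"]
  by (simp add: polytime_const cong: if_cong) (simp add: if_bool_eq_conj)

lemma polytime_conj [polytime_intros]:
  "polytime ec enc_bool b \<Longrightarrow> polytime ec enc_bool c \<Longrightarrow> polytime ec enc_bool (\<lambda>x. b x \<and> c x)"
  using polytime_if[of ec b enc_bool c "\<lambda>_. False"] by (simp add: polytime_const if_bool_eq_conj conj_commute imp_conjR cong: conj_cong)

text \<open>Programs compare trees; injectivity of the encoding turns this into equality of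
  values.\<close>

lemma polytime_eq:
  assumes "inj e" "polytime ec e f" "polytime ec e g"
  shows "polytime ec enc_bool (\<lambda>x. f x = g x)"
proof -
  have "computable ec (\<lambda>x. Node (e (f x)) (e (g x)))"
    using assms(2,3) unfolding polytime_def by (rule computable_Node)
  moreover have "computable (\<lambda>x. Node (e (f x)) (e (g x))) (\<lambda>x. enc_bool (f x = g x))"
  proof -
    obtain P p where "implements P 0 p (\<lambda>(a, b). Node a b) (\<lambda>(a, b). enc_bool (a = b))"
      using computable_eq unfolding computable_def by blast
    then have "implements P 0 p (\<lambda>x. Node (e (f x)) (e (g x))) (\<lambda>x. enc_bool (f x = g x))"
      unfolding implements_def
      by (intro allI) (drule spec[of _ "(e (f _), e (g _))"], simp add: inj_eq[OF assms(1)])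
    then show ?thesis unfolding computable_def by blast
  qed
  ultimately show ?thesis unfolding polytime_def by (rule computable_comp)
qed

lemma polytime_Cons [polytime_intros]:
  "polytime ec e f \<Longrightarrow> polytime ec (enc_list e) g \<Longrightarrow> polytime ec (enc_list e) (\<lambda>x. f x # g x)"
  unfolding polytime_def by (simp add: computable_Node)

lemma polytime_Some [polytime_intros]:
  "polytime ec e f \<Longrightarrow> polytime ec (enc_option e) (\<lambda>x. Some (f x))"
  unfolding polytime_def by (simp add: computable_Node computable_const)

lemma polytime_case_list [polytime_intros]:
  assumes "polytime ec (enc_list ea) L" "polytime ec e f"
    "polytime (enc_pair ea (enc_pair (enc_list ea) ec)) e (\<lambda>p. g (fst p) (fst (snd p)) (snd (snd p)))"
  shows "polytime ec e (\<lambda>x. case L x of [] \<Rightarrow> f x | a # as \<Rightarrow> g a as x)"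
proof -
  \<comment> \<open>\<open>g\<close> is evaluated for empty lists too, because the conditional
    computes both branches. A constant tree stands in for the missing head, and the result is
    discarded.\<close>
  define h where "h x = (if L x = [] then (undefined, [], x) else (hd (L x), tl (L x), x))" for x
  have 1: "computable ec (\<lambda>x. enc_list ea (L x))"
    using assms(1) unfolding polytime_def .
  have h: "(\<lambda>x. enc_pair ea (enc_pair (enc_list ea) ec) (h x)) =
      (\<lambda>x. if enc_list ea (L x) = Leaf then Node (ea undefined) (Node Leaf (ec x))
        else Node (left (enc_list ea (L x))) (Node (right (enc_list ea (L x))) (ec x)))"
  proof
    show "enc_pair ea (enc_pair (enc_list ea) ec) (h x) =
      (if enc_list ea (L x) = Leaf then Node (ea undefined) (Node Leaf (ec x))
        else Node (left (enc_list ea (L x))) (Node (right (enc_list ea (L x))) (ec x)))" for x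
      by (cases "L x") (simp_all add: h_def)
  qed
  have "polytime ec (enc_pair ea (enc_pair (enc_list ea) ec)) h"
    unfolding polytime_def h
    by (intro computable_if computable_Node computable_left computable_right computable_const
        computable_refl 1)
  from polytime_comp[OF this assms(3)]
  have 2: "computable ec (\<lambda>x. e (g (fst (h x)) (fst (snd (h x))) (snd (snd (h x)))))"
    unfolding polytime_def .
  have "(\<lambda>x. e (case L x of [] \<Rightarrow> f x | a # as \<Rightarrow> g a as x)) =
      (\<lambda>x. if enc_list ea (L x) = Leaf then e (f x)
        else e (g (fst (h x)) (fst (snd (h x))) (snd (snd (h x)))))"
    by (rule ext) (auto simp: h_def split: list.split)
  with computable_if[OF 1 2 assms(2)[unfolded polytime_def]] show ?thesis
    unfolding polytime_def by simp
qed

text \<open>An option has the same encoding as a list of length at most one, so the rule for lists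
  applies.\<close>

lemma polytime_case_option [polytime_intros]:
  assumes "polytime ec (enc_option ea) L" "polytime ec e f"
    "polytime (enc_pair ea ec) e (\<lambda>p. g (fst p) (snd p))"
  shows "polytime ec e (\<lambda>x. case L x of None \<Rightarrow> f x | Some a \<Rightarrow> g a x)"
proof -
  define l where "l x = (case L x of None \<Rightarrow> [] | Some a \<Rightarrow> [a])" for x
  have "enc_list ea (l x) = enc_option ea (L x)" for x
    by (auto simp: l_def split: option.split)
  then have "polytime ec (enc_list ea) l"
    using assms(1) unfolding polytime_def by simp
  then have "polytime ec e (\<lambda>x. case l x of [] \<Rightarrow> f x | a # as \<Rightarrow> g a x)"
  proof (rule polytime_case_list[OF _ assms(2)])
    have "polytime (enc_pair ea (enc_pair (enc_list ea) ec)) (enc_pair ea ec)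
        (\<lambda>p. (fst p, snd (snd p)))"
      by (rule polytime_intros)+
    from polytime_comp[OF this assms(3)]
    show "polytime (enc_pair ea (enc_pair (enc_list ea) ec)) e (\<lambda>p. g (fst p) (snd (snd p)))"
      by simp
  qed
  moreover have "(case l x of [] \<Rightarrow> f x | a # as \<Rightarrow> g a x) = (case L x of None \<Rightarrow> f x | Some a \<Rightarrow> g a x)" for x
    by (auto simp: l_def split: option.split)
  ultimately show ?thesis by simp
qed

lemma polytime_rec_list:
  assumes "polytime ec (enc_list ea) L" "polytime ec eb i"
    "polytime (enc_pair ea (enc_pair (enc_list ea) (enc_pair eb ec))) eb
      (\<lambda>p. g (snd (snd (snd p))) (fst p) (fst (snd p)) (fst (snd (snd p))))"
    "\<And>x us zs. L x = us @ zs \<Longrightarrow> size (eb (rec_list (i x) (g x) zs)) \<le> poly q (size (ec x))"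
  shows "polytime ec eb (\<lambda>x. rec_list (i x) (g x) (L x))"
  unfolding polytime_def
proof (rule computable_rec_list[where ea = ea and q = q])
  have "enc_pair ea (enc_pair (enc_list ea) (enc_pair eb ec)) =
      (\<lambda>(a, as, b, x). Node (ea a) (Node (enc_list ea as) (Node (eb b) (ec x))))"
    "(\<lambda>p. eb (g (snd (snd (snd p))) (fst p) (fst (snd p)) (fst (snd (snd p))))) =
      (\<lambda>(a, as, b, x). eb (g x a as b))"
    by auto
  then show "computable (\<lambda>(a, as, b, x). Node (ea a) (Node (enc_list ea as) (Node (eb b) (ec x))))
      (\<lambda>(a, as, b, x). eb (g x a as b))"
    using assms(3) unfolding polytime_def by simp
qed (use assms(1,2,4) in \<open>simp_all add: polytime_def\<close>)

lemma foldr_rec_list: "foldr f xs i = rec_list i (\<lambda>a _. f a) xs"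
  by (induction xs) auto

lemma polytime_foldr:
  assumes "polytime ec (enc_list ea) L" "polytime ec eb i"
    "polytime (enc_pair ea (enc_pair (enc_list ea) (enc_pair eb ec))) eb
      (\<lambda>p. g (snd (snd (snd p))) (fst p) (fst (snd (snd p))))"
    "\<And>x us zs. L x = us @ zs \<Longrightarrow> size (eb (foldr (g x) zs (i x))) \<le> poly q (size (ec x))"
  shows "polytime ec eb (\<lambda>x. foldr (g x) (L x) (i x))"
  unfolding foldr_rec_list
  by (rule polytime_rec_list[OF assms(1-3)]) (use assms(4) in \<open>simp add: foldr_rec_list\<close>)

lemma size_mem_enc_list: "a \<in> set xs \<Longrightarrow> size (e a) < size (enc_list e xs)"
  by (induction xs) auto

text \<open>Steps that enlarge the result by a bounded amount only need no separate size bound.\<close>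

lemma polytime_foldr_additive:
  assumes L: "polytime ec (enc_list ea) L" and i: "polytime ec eb i"
    and g: "polytime (enc_pair ea (enc_pair (enc_list ea) (enc_pair eb ec))) eb
      (\<lambda>p. g (snd (snd (snd p))) (fst p) (fst (snd (snd p))))"
    and step: "\<And>x a b. size (eb (g x a b)) \<le> size (eb b) + poly r (size (ea a) + size (ec x))"
  shows "polytime ec eb (\<lambda>x. foldr (g x) (L x) (i x))"
proof -
  obtain l where l: "size (enc_list ea (L x)) \<le> poly l (size (ec x))" for x
    using size_polytime[OF L] by blast
  obtain k where k: "size (eb (i x)) \<le> poly k (size (ec x))" for x
    using size_polytime[OF i] by blast
  have *: "size (eb (foldr (g x) zs (i x))) \<le>
      size (eb (i x)) + length zs * poly r (size (enc_list ea zs) + size (ec x))" for x zs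
  proof (induction zs)
    case (Cons a zs)
    have "poly r (size (enc_list ea zs) + size (ec x)) \<le> poly r (size (enc_list ea (a # zs)) + size (ec x))"
      by (rule poly_nat_mono) simp
    then have "length zs * poly r (size (enc_list ea zs) + size (ec x)) \<le>
        length zs * poly r (size (enc_list ea (a # zs)) + size (ec x))"
      by (rule mult_le_mono2)
    moreover have "poly r (size (ea a) + size (ec x)) \<le> poly r (size (enc_list ea (a # zs)) + size (ec x))"
      by (rule poly_nat_mono) simp
    ultimately show ?case
      using Cons step[of x a "foldr (g x) zs (i x)"]
      unfolding foldr.simps o_apply list.size(4) add_mult_distrib by linarith
  qed simp
  show ?thesis
  proof (rule polytime_foldr[OF L i g, where q = "k + l * pcompose r (l + [:0, 1:])"])
    fix x us zs
    assume "L x = us @ zs"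
    with l[of x] have zs: "size (enc_list ea zs) \<le> poly l (size (ec x))"
      by (simp add: size_enc_list_append)
    then have "length zs \<le> poly l (size (ec x))"
      using length_le_size_enc_list[of zs ea] by linarith
    moreover from zs have "poly r (size (enc_list ea zs) + size (ec x)) \<le>
        poly r (poly l (size (ec x)) + size (ec x))"
      by (intro poly_nat_mono) simp
    ultimately have "length zs * poly r (size (enc_list ea zs) + size (ec x)) \<le>
        poly l (size (ec x)) * poly r (poly l (size (ec x)) + size (ec x))"
      by (rule mult_le_mono)
    then show "size (eb (foldr (g x) zs (i x))) \<le>
        poly (k + l * pcompose r (l + [:0, 1:])) (size (ec x))"
      using *[where x = x and zs = zs] k[of x] by (simp add: poly_pcompose)
  qed
qed

section \<open>Orienting a multigraph with prescribed outdegrees\<close>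

text \<open>
  An edge carries a label, its current tail (its owner) and its current head. Reversals keep the
  label, so that labels can record the initial orientation.
\<close>

type_synonym ('l, 'v) edge = "'l \<times> 'v \<times> 'v"

abbreviation owner :: "('l, 'v) edge \<Rightarrow> 'v" where "owner e \<equiv> fst (snd e)"
abbreviation other :: "('l, 'v) edge \<Rightarrow> 'v" where "other e \<equiv> snd (snd e)"

definition flip :: "('l, 'v) edge \<Rightarrow> ('l, 'v) edge" where
  "flip e = (fst e, other e, owner e)"

abbreviation owners :: "('l, 'v) edge list \<Rightarrow> 'v multiset" where
  "owners E \<equiv> mset (map owner E)"

definition reorientation :: "('l, 'v) edge list \<Rightarrow> ('l, 'v) edge list \<Rightarrow> bool" where
  "reorientation E F \<longleftrightarrow> list_all2 (\<lambda>e f. f = e \<or> f = flip e) E F"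

text \<open>One augmenting step: a single edge from \<open>v\<close> to a vertex outside
  \<open>U\<close> is reversed. Which of several suitable edges is taken is immaterial.\<close>

primrec push :: "'v \<Rightarrow> 'v list \<Rightarrow> ('l, 'v) edge list \<Rightarrow> ('v \<times> ('l, 'v) edge list) option" where
  "push v U [] = None"
| "push v U (e # E) = (case push v U E of
      None \<Rightarrow> if owner e = v \<and> other e \<notin> set U then Some (other e, flip e # E) else None
    | Some p \<Rightarrow> Some (fst p, e # snd p))"

primrec scan :: "'v list \<Rightarrow> ('v \<times> ('l, 'v) edge list) list \<Rightarrow> ('v \<times> ('l, 'v) edge list) option" where
  "scan U [] = None"
| "scan U (p # R) = (case push (fst p) U (snd p) of None \<Rightarrow> scan U R | Some q \<Rightarrow> Some q)"

definition grow :: "('v \<times> ('l, 'v) edge list) list \<Rightarrow> ('v \<times> ('l, 'v) edge list) list" where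
  "grow R = (case scan (map fst R) R of None \<Rightarrow> R | Some q \<Rightarrow> q # R)"

primrec pick :: "'v list \<Rightarrow> ('v \<times> ('l, 'v) edge list) list \<Rightarrow> (('l, 'v) edge list \<times> 'v list) option" where
  "pick D [] = None"
| "pick D (p # R) = (if fst p \<in> set D then Some (snd p, remove1 (fst p) D) else pick D R)"

text \<open>\<open>E @ E\<close> serves as a counter: at most \<open>2 * length E\<close> vertices
  occur as ends, so that many rounds exhaust the search.\<close>

definition explore :: "('l, 'v) edge list \<Rightarrow> 'v \<Rightarrow> ('v \<times> ('l, 'v) edge list) list" where
  "explore E s = foldr (\<lambda>_. grow) (E @ E) [(s, E)]"

definition add_edge :: "('l, 'v) edge \<Rightarrow> ('l, 'v) edge list \<times> 'v list \<Rightarrow>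
    (('l, 'v) edge list \<times> 'v list) option" where
  "add_edge e p = pick (snd p) (explore (e # fst p) (owner e))"

definition add_edges :: "('l, 'v) edge list \<Rightarrow> 'v list \<Rightarrow> (('l, 'v) edge list \<times> 'v list) option" where
  "add_edges E D =
    foldr (\<lambda>e r. case r of None \<Rightarrow> None | Some p \<Rightarrow> add_edge e p) E (Some ([], D))"

definition orient :: "('l, 'v) edge list \<Rightarrow> 'v list \<Rightarrow> ('l, 'v) edge list option" where
  "orient E D = (case add_edges E D of None \<Rightarrow> None
    | Some p \<Rightarrow> if snd p = [] then Some (fst p) else None)"

lemma flip_flip [simp]: "flip (flip e) = e"
  by (simp add: flip_def)

lemma owner_flip [simp]: "owner (flip e) = other e" and other_flip [simp]: "other (flip e) = owner e"
  by (simp_all add: flip_def)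

lemma reorientation_sym: "reorientation E F \<Longrightarrow> reorientation F E"
  unfolding reorientation_def list_all2_conv_all_nth by (metis flip_flip)

lemma reorientation_trans: "reorientation E F \<Longrightarrow> reorientation F G \<Longrightarrow> reorientation E G"
  unfolding reorientation_def by (rule list_all2_trans[where as = E and bs = F and cs = G]) auto

text \<open>The last claim records that only edges from \<open>v\<close> to \<open>w\<close> change,
  which confines all reversals to reached vertices. The exchange of owners has an addition on each
  side to avoid subtraction of multisets.\<close>

lemma push_Some:
  assumes "push v U E = Some (w, F)"
  shows "w \<notin> set U" "w \<in> other ` set E" "add_mset v (owners F) = add_mset w (owners E)"
    "list_all2 (\<lambda>e f. f = e \<or> f = flip e \<and> owner e = v \<and> other e = w) E F"
proof -
  have "w \<notin> set U \<and> w \<in> other ` set E \<and> add_mset v (owners F) = add_mset w (owners E) \<and>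
    list_all2 (\<lambda>e f. f = e \<or> f = flip e \<and> owner e = v \<and> other e = w) E F"
    using assms
  proof (induction E arbitrary: F)
    case (Cons e E)
    show ?case
    proof (cases "push v U E")
      case None
      with Cons.prems show ?thesis
        by (auto split: if_splits intro: list_all2_refl)
    next
      case (Some p)
      with Cons.prems Cons.IH[of "snd p"] show ?thesis
        by (auto simp: add_mset_commute)
    qed
  qed simp
  then show "w \<notin> set U" "w \<in> other ` set E" "add_mset v (owners F) = add_mset w (owners E)"
    "list_all2 (\<lambda>e f. f = e \<or> f = flip e \<and> owner e = v \<and> other e = w) E F"
    by auto
qed

lemma push_None: "push v U E = None \<Longrightarrow> e \<in> set E \<Longrightarrow> owner e = v \<Longrightarrow> other e \<in> set U"
  by (induction E) (auto split: option.splits if_splits)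

lemma scan_Some: "scan U R = Some q \<Longrightarrow> \<exists>p\<in>set R. push (fst p) U (snd p) = Some q"
  by (induction R) (auto split: option.splits)

lemma scan_None: "scan U R = None \<Longrightarrow> p \<in> set R \<Longrightarrow> push (fst p) U (snd p) = None"
  by (induction R) (auto split: option.splits)

lemma pick_Some: "pick D R = Some q \<Longrightarrow> \<exists>p\<in>set R. fst p \<in> set D \<and> q = (snd p, remove1 (fst p) D)"
  by (induction R) (auto split: if_splits)

lemma pick_None: "pick D R = None \<Longrightarrow> p \<in> set R \<Longrightarrow> fst p \<notin> set D"
  by (induction R) (auto split: if_splits)

section \<open>The set of vertices to which a surplus edge can be passed\<close>

definition ends :: "('l, 'v) edge list \<Rightarrow> 'v set" where
  "ends E = owner ` set E \<union> other ` set E"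

lemma card_ends: "card (ends E) \<le> 2 * length E" and finite_ends [simp]: "finite (ends E)"
proof -
  have "card (ends E) \<le> card (owner ` set E) + card (other ` set E)"
    unfolding ends_def by (rule card_Un_le)
  also have "\<dots> \<le> card (set E) + card (set E)"
    by (intro add_mono card_image_le) simp_all
  also have "\<dots> \<le> 2 * length E"
    using card_length[of E] by simp
  finally show "card (ends E) \<le> 2 * length E" .
qed (simp add: ends_def)

lemma reorientation_ends: "reorientation E F \<Longrightarrow> ends F = ends E"
  unfolding reorientation_def by (induction rule: list_all2_induct) (auto simp: ends_def)

text \<open>
  The entries \<open>(v, F)\<close> of \<open>R\<close> stand for the vertices reached from \<open>s\<close>: in \<open>F\<close> the vertex \<open>v\<close> owns
  an additional edge at the expense of \<open>s\<close>, and only edges between reached vertices are reversed.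
\<close>

definition reached :: "('l, 'v) edge list \<Rightarrow> 'v \<Rightarrow> ('v \<times> ('l, 'v) edge list) list \<Rightarrow> bool" where
  "reached E s R \<longleftrightarrow> s \<in> fst ` set R \<and> fst ` set R \<subseteq> ends E \<and> distinct (map fst R) \<and>
    (\<forall>(v, F)\<in>set R. add_mset s (owners F) = add_mset v (owners E) \<and>
      list_all2 (\<lambda>e f. f = e \<or> f = flip e \<and> owner e \<in> fst ` set R \<and> other e \<in> fst ` set R) E F)"

lemma reached_grow:
  assumes "reached E s R"
  shows "reached E s (grow R)"
proof (cases "scan (map fst R) R")
  case None
  with assms show ?thesis by (simp add: grow_def)
next
  case (Some q)
  obtain w G where q: "q = (w, G)" by force
  obtain v F where F: "(v, F) \<in> set R" "push v (map fst R) F = Some (w, G)"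
    using scan_Some[OF Some] q by auto
  let ?P = "\<lambda>X e f. f = e \<or> f = flip e \<and> owner e \<in> X \<and> other e \<in> X"
  let ?X = "fst ` set R"
  have v: "v \<in> ?X" using F(1) by force
  have EF: "add_mset s (owners F) = add_mset v (owners E)" "list_all2 (?P ?X) E F"
    using assms F(1) unfolding reached_def by auto
  have "reorientation E F"
    using EF(2) unfolding reorientation_def by (rule list_all2_mono) auto
  then have w: "w \<in> ends E"
    using push_Some(2)[OF F(2)] reorientation_ends[of E F] by (auto simp: ends_def)
  have "add_mset v (add_mset s (owners G)) = add_mset s (add_mset w (owners F))"
    using push_Some(3)[OF F(2)] by (simp add: add_mset_commute)
  also have "\<dots> = add_mset v (add_mset w (owners E))"
    using EF(1) by (simp add: add_mset_commute)
  finally have G: "add_mset s (owners G) = add_mset w (owners E)"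
    by simp
  \<comment> \<open>The edge reversed last joins \<open>v\<close> to the new vertex
    \<open>w\<close>, so it lies within the enlarged set as well.\<close>
  have "list_all2 (?P (insert w ?X)) E G"
    by (rule list_all2_trans[OF _ EF(2) push_Some(4)[OF F(2)]]) (use v in auto)
  moreover have "list_all2 (?P (insert w ?X)) E F'" if "(v', F') \<in> set R" for v' F'
    by (rule list_all2_mono[of "?P ?X"]) (use assms that in \<open>auto simp: reached_def\<close>)
  moreover have "w \<notin> ?X"
    using push_Some(1)[OF F(2)] by simp
  ultimately show ?thesis
    using assms w G Some unfolding reached_def grow_def q by auto
qed

lemma reached_foldr_grow:
  assumes "s \<in> ends E"
  shows "reached E s (foldr (\<lambda>_. grow) xs [(s, E)])"
proof (induction xs)
  case Nil
  then show ?case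
    using assms by (auto simp: reached_def intro: list_all2_refl)
qed (simp add: reached_grow)

lemma reached_explore: "s \<in> ends E \<Longrightarrow> reached E s (explore E s)"
  unfolding explore_def by (rule reached_foldr_grow)

text \<open>Every successful round reaches a new vertex. If a scan still succeeded at the end, all
  \<open>2 * length E\<close> rounds would have, and with the start there would be more reached
  vertices than ends.\<close>

lemma scan_explore:
  assumes "s \<in> ends E"
  shows "scan (map fst (explore E s)) (explore E s) = None"
proof (rule ccontr)
  assume not: "scan (map fst (explore E s)) (explore E s) \<noteq> None"
  have *: "scan (map fst R) R = None \<or> length R = length xs + 1"
    if "R = foldr (\<lambda>_. grow) xs [(s, E)]" for R xs
    using that
  proof (induction xs arbitrary: R)
    case (Cons x xs)
    define R' where "R' = foldr (\<lambda>_. grow) xs [(s, E)]"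
    have R: "R = grow R'" using Cons.prems by (simp add: R'_def)
    show ?case
      using Cons.IH[OF R'_def] by (cases "scan (map fst R') R'") (auto simp: R grow_def)
  qed simp
  have len: "length (explore E s) = 2 * length E + 1"
    using *[OF explore_def] not by simp
  from reached_explore[OF assms] have "card (fst ` set (explore E s)) \<le> card (ends E)"
    by (intro card_mono) (auto simp: reached_def)
  moreover from reached_explore[OF assms] have "card (fst ` set (explore E s)) = length (explore E s)"
    unfolding reached_def by (metis distinct_card length_map list.set_map)
  ultimately show False
    using len card_ends[of E] by simp
qed

text \<open>Closure is needed for the original orientation \<open>E\<close>, whereas the search from
  \<open>owner e\<close> looks at the stored one, \<open>F\<close>. Where they differ at
  \<open>e\<close>, both ends have been reached anyway; where they agree, the exhausted scan leaves
  no edge out of the reached set.\<close>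

lemma explore_closed:
  assumes "s \<in> ends E" "e \<in> set E" "owner e \<in> fst ` set (explore E s)"
  shows "other e \<in> fst ` set (explore E s)"
proof -
  let ?R = "explore E s"
  obtain F where F: "(owner e, F) \<in> set ?R" using assms(3) by force
  with reached_explore[OF assms(1)]
  have l: "list_all2 (\<lambda>e f. f = e \<or> f = flip e \<and> owner e \<in> fst ` set ?R \<and> other e \<in> fst ` set ?R) E F"
    unfolding reached_def by auto
  obtain i where i: "i < length E" "e = E ! i"
    using assms(2) by (metis in_set_conv_nth)
  have "F ! i \<in> set F"
    using i(1) list_all2_lengthD[OF l] by simp
  moreover have "F ! i = e \<or> other e \<in> fst ` set ?R"
    using list_all2_nthD[OF l i(1)] i(2) by blast
  moreover have "other f \<in> set (map fst ?R)" if "f \<in> set F" "owner f = owner e" for f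
    using push_None[OF scan_None[OF scan_explore[OF assms(1)] F, simplified]] that by simp
  ultimately show ?thesis by (metis list.set_map)
qed

text \<open>Edges owned by a closed set have both ends in it, so that it owns them in every orientation.\<close>

lemma closed_owners_mono:
  assumes "reorientation E F" "\<And>e. e \<in> set E \<Longrightarrow> owner e \<in> X \<Longrightarrow> other e \<in> X"
  shows "size (filter_mset (\<lambda>v. v \<in> X) (owners E)) \<le> size (filter_mset (\<lambda>v. v \<in> X) (owners F))"
  using assms unfolding reorientation_def
proof (induction rule: list_all2_induct)
  case (Cons e E f F)
  have "owner e \<in> X \<Longrightarrow> owner f \<in> X"
    using Cons.hyps(1) Cons.prems[of e] owner_flip[of e] by auto
  moreover have "size (filter_mset (\<lambda>v. v \<in> X) (owners E)) \<le> size (filter_mset (\<lambda>v. v \<in> X) (owners F))"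
    using Cons.IH Cons.prems by simp
  ultimately show ?case by simp
qed simp

section \<open>Inserting the edges one by one\<close>

lemma add_edge_Some:
  assumes "add_edge e (E, D) = Some (F, D')"
  shows "reorientation (e # E) F" "owners F + mset D' = owners E + mset D"
proof -
  have s: "owner e \<in> ends (e # E)" by (simp add: ends_def)
  obtain v where v: "(v, F) \<in> set (explore (e # E) (owner e))" "v \<in> set D" "D' = remove1 v D"
    using pick_Some[of D] assms unfolding add_edge_def by fastforce
  then have F: "add_mset (owner e) (owners F) = add_mset v (owners (e # E))"
    "list_all2 (\<lambda>x y. y = x \<or> y = flip x \<and> owner x \<in> fst ` set (explore (e # E) (owner e)) \<and>
      other x \<in> fst ` set (explore (e # E) (owner e))) (e # E) F"
    using reached_explore[OF s] unfolding reached_def by blast+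
  show "reorientation (e # E) F"
    unfolding reorientation_def by (rule list_all2_mono[OF F(2)]) auto
  have "owners F = add_mset v (owners E)"
    using F(1) by (simp add: add_mset_commute)
  then show "owners F + mset D' = owners E + mset D"
    using v by simp
qed

text \<open>Counting in the reached set \<open>X\<close>: no vertex of it has demand left, so it is
  allowed only as many edges as it owns in \<open>E\<close>. Being closed, it owns in
  \<open>F\<close> at least those and one more, because \<open>owner e\<close> belongs to
  it.\<close>

lemma add_edge_None:
  assumes "add_edge e (E, D) = None" "reorientation (e # E) F"
  shows "\<not> owners F \<subseteq># owners E + mset D"
proof
  assume sub: "owners F \<subseteq># owners E + mset D"
  have s: "owner e \<in> ends (e # E)" by (simp add: ends_def)
  define X where "X = fst ` set (explore (e # E) (owner e))"
  have sX: "owner e \<in> X"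
    using reached_explore[OF s] by (simp add: reached_def X_def)
  have D: "v \<notin> X" if "v \<in> set D" for v
    using pick_None[of D "explore (e # E) (owner e)"] assms(1) that
    unfolding add_edge_def X_def fst_conv snd_conv by blast
  have "size (filter_mset (\<lambda>v. v \<in> X) (owners (e # E))) \<le> size (filter_mset (\<lambda>v. v \<in> X) (owners F))"
    using closed_owners_mono[OF assms(2)] explore_closed[OF s] unfolding X_def by blast
  also have "\<dots> \<le> size (filter_mset (\<lambda>v. v \<in> X) (owners E + mset D))"
    by (intro size_mset_mono multiset_filter_mono sub)
  also have "\<dots> = size (filter_mset (\<lambda>v. v \<in> X) (owners E))"
    using D by (simp add: filter_mset_eq_conv[of _ _ "{#}"])
  finally show False using sX by simp
qed

lemma add_edges_Some:
  "add_edges E D = Some (F, D') \<Longrightarrow> reorientation E F \<and> owners F + mset D' = mset D"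
proof (induction E arbitrary: F D')
  case Nil
  then show ?case by (simp add: add_edges_def reorientation_def)
next
  case (Cons e E)
  obtain G H where G: "add_edges E D = Some (G, H)" "add_edge e (G, H) = Some (F, D')"
    using Cons.prems unfolding add_edges_def by (auto split: option.splits)
  note IH = Cons.IH[OF G(1)] and F = add_edge_Some[OF G(2)]
  have "reorientation (e # E) (e # G)"
    using IH by (simp add: reorientation_def)
  then have "reorientation (e # E) F"
    using F(1) by (rule reorientation_trans)
  with IH F(2) show ?case by simp
qed

text \<open>Infeasibility is stated with \<open>\<subseteq>#\<close> instead of equality so that it
  passes from a suffix of the edges to the whole list: the owners of a part are among the owners of
  all.\<close>

lemma add_edges_None:
  "add_edges E D = None \<Longrightarrow> reorientation E F \<Longrightarrow> \<not> owners F \<subseteq># mset D"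
proof (induction E arbitrary: F)
  case Nil
  then show ?case by (simp add: add_edges_def)
next
  case (Cons e E)
  obtain f F' where F: "F = f # F'" "reorientation E F'" "f = e \<or> f = flip e"
    using Cons.prems(2) by (auto simp: reorientation_def list_all2_Cons1)
  show ?case
  proof (cases "add_edges E D")
    case None
    have "owners F' \<subseteq># owners F" by (simp add: F(1))
    with Cons.IH[OF None F(2)] show ?thesis
      using subset_mset.order_trans by blast
  next
    case (Some p)
    obtain G H where p: "p = (G, H)" by force
    note S = add_edges_Some[OF Some[unfolded p]]
    have "add_edge e (G, H) = None"
      using Cons.prems(1) Some p by (simp add: add_edges_def)
    \<comment> \<open>\<open>G\<close> and \<open>F'\<close> reorient the same \<open>E\<close>,
      hence each other, so \<open>F\<close> can be refuted against the current orientation.\<close>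
    moreover have "reorientation (e # G) F"
    proof -
      have "reorientation G F'"
        using S F(2) reorientation_trans reorientation_sym by blast
      then show ?thesis
        using F by (simp add: reorientation_def)
    qed
    ultimately show ?thesis
      using add_edge_None[of e G H F] S by simp
  qed
qed

lemma orient_Some:
  assumes "orient E D = Some F"
  shows "reorientation E F" "owners F = mset D"
proof -
  obtain H where "add_edges E D = Some (F, H)" "H = []"
    using assms by (auto simp: orient_def split: option.splits if_splits)
  with add_edges_Some[of E D F H] show "reorientation E F" "owners F = mset D" by simp_all
qed

lemma orient_None:
  assumes "orient E D = None" "reorientation E F"
  shows "owners F \<noteq> mset D"
proof (cases "add_edges E D")
  case None
  with add_edges_None[OF None assms(2)] show ?thesis by auto
next
  case (Some p)
  obtain G H where p: "p = (G, H)" by force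
  from add_edges_Some[OF Some[unfolded p]] have G: "reorientation E G" "owners G + mset H = mset D"
    by simp_all
  \<comment> \<open>Leftover demands mean more demands than edges, so the sizes cannot match in any
    orientation.\<close>
  have "H \<noteq> []"
    using assms(1) Some p by (simp add: orient_def split: if_splits)
  moreover have "length F = length G"
    using list_all2_lengthD[OF G(1)[unfolded reorientation_def]]
      list_all2_lengthD[OF assms(2)[unfolded reorientation_def]] by simp
  moreover have "length G + length H = length D"
    using arg_cong[OF G(2), of size] by simp
  ultimately have "size (owners F) \<noteq> size (mset D)"
    by (cases H) simp_all
  then show ?thesis by metis
qed

section \<open>Polynomial-time list functions\<close>

lemma size_enc_bool: "size (enc_bool b) \<le> Suc 0"
  by (simp add: enc_bool_def)

lemma size_enc_list_le: "(\<And>a. a \<in> set xs \<Longrightarrow> size (e a) \<le> B) \<Longrightarrow> size (enc_list e xs) \<le> length xs * (B + 1)"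
  by (induction xs) force+

text \<open>The size does not depend on the order, so lists can be compared through their multisets;
  this bounds \<open>remove1\<close> and the leftover demands.\<close>

lemma size_enc_list_mset: "size (enc_list e xs) = (\<Sum>a\<in>#mset xs. size (e a) + 1)"
  by (induction xs) auto

lemma size_enc_list_mset_mono:
  assumes "mset xs \<subseteq># mset ys"
  shows "size (enc_list e xs) \<le> size (enc_list e ys)"
proof -
  obtain M where "mset ys = mset xs + M"
    using assms by (metis subset_mset.add_diff_inverse)
  then show ?thesis by (simp add: size_enc_list_mset)
qed

lemma foldr_Cons: "foldr (\<lambda>a b. a # b) xs ys = xs @ ys"
  by (induction xs) auto

lemma foldr_Cons_map: "foldr (\<lambda>a b. f a # b) xs [] = map f xs"
  by (induction xs) auto

lemma foldr_append_concat: "foldr (\<lambda>a b. a @ b) xs [] = concat xs"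
  by (induction xs) auto

lemma foldr_conj: "foldr (\<lambda>a b. f a \<and> b) xs True \<longleftrightarrow> (\<forall>a\<in>set xs. f a)"
  by (induction xs) auto

lemma rec_list_remove1: "rec_list [] (\<lambda>b as r. if a = b then as else b # r) xs = remove1 a xs"
  by (induction xs) auto

lemma polytime_append [polytime_intros]:
  assumes "polytime ec (enc_list e) f" "polytime ec (enc_list e) g"
  shows "polytime ec (enc_list e) (\<lambda>x. f x @ g x)"
proof -
  have "polytime ec (enc_list e) (\<lambda>x. foldr (\<lambda>a b. a # b) (f x) (g x))"
    by (rule polytime_foldr_additive[OF assms, where r = "[:1, 1:]"]) (rule polytime_intros | simp)+
  then show ?thesis unfolding foldr_Cons .
qed

lemma polytime_map [polytime_intros]:
  assumes "polytime ec (enc_list ea) L" "polytime (enc_pair ea ec) eb (\<lambda>p. f (snd p) (fst p))"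
  shows "polytime ec (enc_list eb) (\<lambda>x. map (f x) (L x))"
proof -
  obtain p where p: "size (eb (f (snd y) (fst y))) \<le> poly p (size (enc_pair ea ec y))" for y
    using size_polytime[OF assms(2)] by blast
  have "polytime ec (enc_list eb) (\<lambda>x. foldr (\<lambda>a b. f x a # b) (L x) [])"
  proof (rule polytime_foldr_additive[OF assms(1), where r = "1 + pcompose p [:1, 1:]"])
    let ?e = "enc_pair ea (enc_pair (enc_list ea) (enc_pair (enc_list eb) ec))"
    have "polytime ?e (enc_pair ea ec) (\<lambda>p. (fst p, snd (snd (snd p))))"
      by (rule polytime_intros)+
    from polytime_comp[OF this assms(2)]
    have f: "polytime ?e eb (\<lambda>p. f (snd (snd (snd p))) (fst p))"
      by simp
    show "polytime ?e (enc_list eb) (\<lambda>p. f (snd (snd (snd p))) (fst p) # fst (snd (snd p)))"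
      by (rule polytime_intros f)+
    show "size (enc_list eb (f x a # b)) \<le> size (enc_list eb b) +
        poly (1 + pcompose p [:1, 1:]) (size (ea a) + size (ec x))" for x a b
      using p[of "(a, x)"] by (simp add: poly_pcompose)
  qed (rule polytime_intros)
  then show ?thesis unfolding foldr_Cons_map .
qed

lemma polytime_concat [polytime_intros]:
  assumes "polytime ec (enc_list (enc_list e)) f"
  shows "polytime ec (enc_list e) (\<lambda>x. concat (f x))"
proof -
  have "polytime ec (enc_list e) (\<lambda>x. foldr (\<lambda>a b. a @ b) (f x) [])"
    by (rule polytime_foldr_additive[OF assms, where r = "[:0, 1:]"])
      (rule polytime_intros | simp add: size_enc_list_append)+
  then show ?thesis unfolding foldr_append_concat .
qed

lemma polytime_ball [polytime_intros]:
  assumes "polytime ec (enc_list ea) L" "polytime (enc_pair ea ec) enc_bool (\<lambda>p. f (snd p) (fst p))"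
  shows "polytime ec enc_bool (\<lambda>x. \<forall>a\<in>set (L x). f x a)"
proof -
  have "polytime ec enc_bool (\<lambda>x. foldr (\<lambda>a b. f x a \<and> b) (L x) True)"
  proof (rule polytime_foldr[OF assms(1), where q = 1])
    let ?e = "enc_pair ea (enc_pair (enc_list ea) (enc_pair enc_bool ec))"
    have "polytime ?e (enc_pair ea ec) (\<lambda>p. (fst p, snd (snd (snd p))))"
      by (rule polytime_intros)+
    from polytime_comp[OF this assms(2)]
    have f: "polytime ?e enc_bool (\<lambda>p. f (snd (snd (snd p))) (fst p))"
      by simp
    show "polytime ?e enc_bool (\<lambda>p. f (snd (snd (snd p))) (fst p) \<and> fst (snd (snd p)))"
      by (rule polytime_intros f)+
  qed (rule polytime_intros | simp add: size_enc_bool)+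
  then show ?thesis unfolding foldr_conj .
qed

lemma polytime_null:
  assumes "polytime ec (enc_list e) f"
  shows "polytime ec enc_bool (\<lambda>x. f x = [])"
proof -
  have "polytime ec enc_bool (\<lambda>x. case f x of [] \<Rightarrow> True | a # as \<Rightarrow> False)"
    by (rule polytime_intros assms)+
  moreover have "(\<lambda>x. case f x of [] \<Rightarrow> True | a # as \<Rightarrow> False) = (\<lambda>x. f x = [])"
    by (rule ext) (simp split: list.split)
  ultimately show ?thesis by simp
qed

lemma polytime_member:
  assumes "inj e" "polytime ec e f" "polytime ec (enc_list e) L"
  shows "polytime ec enc_bool (\<lambda>x. f x \<in> set (L x))"
proof -
  have "polytime (enc_pair e ec) ec snd"
    using polytime_snd[OF polytime_var] .
  from polytime_comp[OF this assms(2)]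
  have "polytime (enc_pair e ec) e (\<lambda>p. f (snd p))" .
  with assms(1) have "polytime (enc_pair e ec) enc_bool (\<lambda>p. f (snd p) = fst p)"
    by (rule polytime_eq) (rule polytime_intros)+
  then have "polytime ec enc_bool (\<lambda>x. \<not> (\<forall>a\<in>set (L x). \<not> f x = a))"
    by (intro polytime_not polytime_ball[OF assms(3)])
  then show ?thesis by simp
qed

lemma polytime_remove1:
  assumes "inj e" "polytime ec e f" "polytime ec (enc_list e) L"
  shows "polytime ec (enc_list e) (\<lambda>x. remove1 (f x) (L x))"
proof -
  obtain l where l: "size (enc_list e (L x)) \<le> poly l (size (ec x))" for x
    using size_polytime[OF assms(3)] by blast
  have "polytime ec (enc_list e) (\<lambda>x. rec_list [] (\<lambda>b as r. if f x = b then as else b # r) (L x))"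
  proof (rule polytime_rec_list[OF assms(3), where q = l])
    let ?e = "enc_pair e (enc_pair (enc_list e) (enc_pair (enc_list e) ec))"
    have "polytime ?e ec (\<lambda>p. snd (snd (snd p)))"
      by (rule polytime_intros)+
    from polytime_comp[OF this assms(2)]
    have f: "polytime ?e e (\<lambda>p. f (snd (snd (snd p))))" .
    show "polytime ?e (enc_list e)
        (\<lambda>p. if f (snd (snd (snd p))) = fst p then fst (snd p) else fst p # fst (snd (snd p)))"
      by (rule polytime_intros polytime_eq[OF assms(1)] f)+
    show "size (enc_list e (rec_list [] (\<lambda>b as r. if f x = b then as else b # r) zs)) \<le> poly l (size (ec x))"
      if "L x = us @ zs" for x us zs
      unfolding rec_list_remove1
      using size_enc_list_mset_mono[of "remove1 (f x) zs" "L x" e] that l[of x]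
      by (simp add: rec_list_remove1 subset_mset.add_increasing)
  qed (rule polytime_intros)
  then show ?thesis unfolding rec_list_remove1 .
qed

section \<open>Orientations in polynomial time\<close>

abbreviation enc_edge :: "('l \<Rightarrow> data) \<Rightarrow> ('v \<Rightarrow> data) \<Rightarrow> ('l, 'v) edge \<Rightarrow> data" where
  "enc_edge el ev \<equiv> enc_pair el (enc_pair ev ev)"

text \<open>Owner and other end are encoded alike, so no number of reversals makes a stored
  orientation grow.\<close>

lemma size_reorientation:
  "reorientation E F \<Longrightarrow> size (enc_list (enc_edge el ev) F) = size (enc_list (enc_edge el ev) E)"
  unfolding reorientation_def by (induction rule: list_all2_induct) (auto simp: flip_def)

lemma size_ends: "v \<in> ends E \<Longrightarrow> size (ev v) \<le> size (enc_list (enc_edge el ev) E)"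
  unfolding ends_def using size_mem_enc_list[of _ E "enc_edge el ev"] by fastforce

lemma polytime_flip [polytime_intros]:
  "polytime ec (enc_edge el ev) f \<Longrightarrow> polytime ec (enc_edge el ev) (\<lambda>x. flip (f x))"
  unfolding flip_def by (rule polytime_intros | assumption)+

lemma size_push:
  assumes "push v U E = Some q"
  shows "size (enc_pair ev (enc_list (enc_edge el ev)) q) \<le> 2 * size (enc_list (enc_edge el ev) E) + 1"
proof -
  obtain w F where q: "q = (w, F)" by force
  have "reorientation E F"
    unfolding reorientation_def
    by (rule list_all2_mono[OF push_Some(4)[OF assms[unfolded q]]]) auto
  then have "size (enc_list (enc_edge el ev) F) = size (enc_list (enc_edge el ev) E)"
    by (rule size_reorientation)
  moreover have "size (ev w) \<le> size (enc_list (enc_edge el ev) E)"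
    using push_Some(2)[OF assms[unfolded q]] by (intro size_ends) (simp add: ends_def)
  ultimately show ?thesis by (simp add: q)
qed

lemma push_rec_list: "push v U = rec_list None (\<lambda>e E r. case r of
    None \<Rightarrow> if owner e = v \<and> \<not> other e \<in> set U then Some (other e, flip e # E) else None
    | Some p \<Rightarrow> Some (fst p, e # snd p))"
  by (rule ext, induct_tac x) (simp_all split: option.split)

lemma polytime_push:
  assumes "inj ev" "polytime ec ev f" "polytime ec (enc_list ev) U"
    "polytime ec (enc_list (enc_edge el ev)) E"
  shows "polytime ec (enc_option (enc_pair ev (enc_list (enc_edge el ev)))) (\<lambda>x. push (f x) (U x) (E x))"
proof -
  let ?ee = "enc_list (enc_edge el ev)"
  let ?eo = "enc_option (enc_pair ev ?ee)"
  \<comment> \<open>The function is first treated on the tuple of its own arguments, because the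
    size bound can then refer to their encodings; composition gives the general case.\<close>
  have "polytime ec (enc_pair ev (enc_pair (enc_list ev) ?ee)) (\<lambda>x. (f x, U x, E x))"
    by (rule polytime_intros assms)+
  moreover have "polytime (enc_pair ev (enc_pair (enc_list ev) ?ee)) ?eo
      (\<lambda>p. push (fst p) (fst (snd p)) (snd (snd p)))"
  proof -
    show ?thesis
      unfolding push_rec_list
    proof (rule polytime_rec_list[where q = "[:2, 2:]"], goal_cases)
      case (4 x us zs)
      have "size (?ee zs) \<le> size (?ee (snd (snd x)))"
        unfolding 4 size_enc_list_append by simp
      moreover have "size (?eo (push (fst x) (fst (snd x)) zs)) \<le> 2 * size (?ee zs) + 2"
        using size_push[of "fst x" "fst (snd x)" zs _ ev el]
        by (cases "push (fst x) (fst (snd x)) zs") force+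
      ultimately show ?case
        unfolding push_rec_list[symmetric] by (simp add: enc_pair_eq)
    qed (rule polytime_intros polytime_eq[OF assms(1)] polytime_member[OF assms(1)])+
  qed
  ultimately show ?thesis using polytime_comp by fastforce
qed

lemma scan_rec_list: "scan U = rec_list None (\<lambda>p R r. case push (fst p) U (snd p) of None \<Rightarrow> r | Some q \<Rightarrow> Some q)"
  by (rule ext, induct_tac x) (simp_all split: option.split)

lemma polytime_scan:
  assumes "inj ev" "polytime ec (enc_list ev) U"
    "polytime ec (enc_list (enc_pair ev (enc_list (enc_edge el ev)))) R"
  shows "polytime ec (enc_option (enc_pair ev (enc_list (enc_edge el ev)))) (\<lambda>x. scan (U x) (R x))"
proof -
  let ?ee = "enc_list (enc_edge el ev)"
  let ?eo = "enc_option (enc_pair ev ?ee)" and ?er = "enc_list (enc_pair ev ?ee)"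
  have "polytime ec (enc_pair (enc_list ev) ?er) (\<lambda>x. (U x, R x))"
    by (rule polytime_intros assms)+
  moreover have "polytime (enc_pair (enc_list ev) ?er) ?eo (\<lambda>p. scan (fst p) (snd p))"
  proof -
    show ?thesis
      unfolding scan_rec_list
    proof (rule polytime_rec_list[where q = "[:2, 2:]"], goal_cases)
      case (4 x us zs)
      have "size (?eo (scan (fst x) zs)) \<le> 2 * size (?er (snd x)) + 2"
      proof (cases "scan (fst x) zs")
        case (Some q)
        then obtain p where p: "p \<in> set zs" "push (fst p) (fst x) (snd p) = Some q"
          using scan_Some by blast
        have "size (enc_pair ev ?ee p) < size (?er (snd x))"
          using p(1) 4 by (intro size_mem_enc_list) simp
        with size_push[OF p(2), of ev el] Some show ?thesis
          by (simp add: enc_pair_eq)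
      qed simp
      then show ?case
        unfolding scan_rec_list[symmetric] by (simp add: enc_pair_eq)
    qed (rule polytime_intros polytime_push[OF assms(1)])+
  qed
  ultimately show ?thesis using polytime_comp by fastforce
qed

lemma polytime_grow:
  assumes "inj ev" "polytime ec (enc_list (enc_pair ev (enc_list (enc_edge el ev)))) R"
  shows "polytime ec (enc_list (enc_pair ev (enc_list (enc_edge el ev)))) (\<lambda>x. grow (R x))"
proof -
  let ?er = "enc_list (enc_pair ev (enc_list (enc_edge el ev)))"
  have "polytime ?er ?er grow"
    unfolding grow_def by (rule polytime_intros polytime_scan[OF assms(1)])+
  with assms(2) show ?thesis by (rule polytime_comp)
qed

text \<open>The start is the owner of a listed edge, hence an end, so \<open>reached\<close> holds
  for all inputs; the size bound is read off from that invariant.\<close>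

lemma polytime_explore:
  assumes "inj ev" "polytime ec (enc_edge el ev) e" "polytime ec (enc_list (enc_edge el ev)) E"
  shows "polytime ec (enc_list (enc_pair ev (enc_list (enc_edge el ev))))
    (\<lambda>x. explore (e x # E x) (owner (e x)))"
proof -
  let ?ee = "enc_list (enc_edge el ev)"
  let ?er = "enc_list (enc_pair ev ?ee)"
  let ?ec = "enc_pair (enc_edge el ev) ?ee"
  have "polytime ec ?ec (\<lambda>x. (e x, E x))"
    by (rule polytime_intros assms)+
  moreover have "polytime ?ec ?er (\<lambda>p. explore (fst p # snd p) (owner (fst p)))"
    unfolding explore_def
  \<comment> \<open>The first factor bounds the number of entries by the number of ends, the second
    the size of an entry, which is a vertex with an orientation of the size of the input
    edges.\<close>
  proof (rule polytime_foldr[where ea = "enc_edge el ev" and q = "[:0, 2:] * [:2, 2:]"], goal_cases)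
    case (4 x us zs)
    let ?R = "foldr (\<lambda>_. grow) zs [(owner (fst x), fst x # snd x)]" and ?E = "fst x # snd x"
    have R: "reached ?E (owner (fst x)) ?R"
      by (rule reached_foldr_grow) (simp add: ends_def)
    have "size (enc_pair ev ?ee p) \<le> 2 * size (?ee ?E) + 1" if "p \<in> set ?R" for p
    proof -
      obtain v F where p: "p = (v, F)" by force
      have "reorientation ?E F"
        using R that unfolding p reached_def reorientation_def
        by (auto elim!: list_all2_mono dest!: bspec[of _ _ "(v, F)"])
      then have "size (?ee F) = size (?ee ?E)" by (rule size_reorientation)
      moreover have "size (ev v) \<le> size (?ee ?E)"
        using R that unfolding p reached_def by (intro size_ends) force
      ultimately show ?thesis by (simp add: p)
    qed
    then have "size (?er ?R) \<le> length ?R * (2 * size (?ee ?E) + 1 + 1)"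
      by (rule size_enc_list_le)
    also have "\<dots> \<le> 2 * size (?ec x) * (2 * size (?ec x) + 2)"
    proof (rule mult_le_mono)
      have "length ?R = card (fst ` set ?R)"
        using R distinct_card[of "map fst ?R"] by (simp add: reached_def)
      also have "\<dots> \<le> card (ends ?E)"
        using R by (intro card_mono) (auto simp: reached_def)
      also have "\<dots> \<le> 2 * length ?E"
        by (rule card_ends)
      also have "\<dots> \<le> 2 * size (?ec x)"
        using length_le_size_enc_list[of "snd x" "enc_edge el ev"] by (simp add: enc_pair_eq)
      finally show "length ?R \<le> 2 * size (?ec x)" .
    qed (simp add: enc_pair_eq)
    finally show ?case by (simp add: algebra_simps)
  qed (rule polytime_intros polytime_grow[OF assms(1)])+
  ultimately show ?thesis using polytime_comp by fastforce
qed

lemma pick_rec_list: "pick D = rec_list None (\<lambda>p R r. if fst p \<in> set D then Some (snd p, remove1 (fst p) D) else r)"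
  by (rule ext, induct_tac x) (simp_all split: option.split)

lemma polytime_pick:
  assumes "inj ev" "polytime ec (enc_list ev) D"
    "polytime ec (enc_list (enc_pair ev (enc_list (enc_edge el ev)))) R"
  shows "polytime ec (enc_option (enc_pair (enc_list (enc_edge el ev)) (enc_list ev)))
    (\<lambda>x. pick (D x) (R x))"
proof -
  let ?ee = "enc_list (enc_edge el ev)"
  let ?eo = "enc_option (enc_pair ?ee (enc_list ev))" and ?er = "enc_list (enc_pair ev ?ee)"
  have "polytime ec (enc_pair (enc_list ev) ?er) (\<lambda>x. (D x, R x))"
    by (rule polytime_intros assms)+
  moreover have "polytime (enc_pair (enc_list ev) ?er) ?eo (\<lambda>p. pick (fst p) (snd p))"
  proof -
    show ?thesis
      unfolding pick_rec_list
    proof (rule polytime_rec_list[where q = "[:2, 2:]"], goal_cases)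
      case (4 x us zs)
      have "size (?eo (pick (fst x) zs)) \<le> size (?er (snd x)) + size (enc_list ev (fst x)) + 2"
      proof (cases "pick (fst x) zs")
        case (Some q)
        then obtain p where p: "p \<in> set zs" "q = (snd p, remove1 (fst p) (fst x))"
          using pick_Some by blast
        have "size (enc_pair ev ?ee p) < size (?er (snd x))"
          using p(1) 4 by (intro size_mem_enc_list) simp
        moreover have "size (enc_list ev (remove1 (fst p) (fst x))) \<le> size (enc_list ev (fst x))"
          by (rule size_enc_list_mset_mono) simp
        ultimately show ?thesis
          using Some by (simp add: p(2) enc_pair_eq)
      qed simp
      then show ?case
        unfolding pick_rec_list[symmetric] by (simp add: enc_pair_eq)
    qed (rule polytime_intros polytime_member[OF assms(1)] polytime_remove1[OF assms(1)])+
  qed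
  ultimately show ?thesis using polytime_comp by fastforce
qed

lemma polytime_orient:
  assumes "inj ev" "polytime ec (enc_list (enc_edge el ev)) E" "polytime ec (enc_list ev) D"
  shows "polytime ec (enc_option (enc_list (enc_edge el ev))) (\<lambda>x. orient (E x) (D x))"
proof -
  let ?ee = "enc_list (enc_edge el ev)"
  let ?ec = "enc_pair ?ee (enc_list ev)"
  have "polytime ec ?ec (\<lambda>x. (E x, D x))"
    by (rule polytime_intros assms)+
  moreover have "polytime ?ec (enc_option ?ec) (\<lambda>p. add_edges (fst p) (snd p))"
    unfolding add_edges_def
  proof (rule polytime_foldr[where ea = "enc_edge el ev" and q = "[:2, 2:]"], goal_cases)
    case (4 x us zs)
    have zs: "size (?ee zs) \<le> size (?ee (fst x))"
      unfolding 4 size_enc_list_append by simp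
    have "size (enc_option ?ec (add_edges zs (snd x))) \<le> size (?ec x) + 2"
    proof (cases "add_edges zs (snd x)")
      case (Some p)
      obtain F D' where p: "p = (F, D')" by force
      from add_edges_Some[OF Some[unfolded p]]
      have "reorientation zs F" "mset D' \<subseteq># mset (snd x)"
        by (simp, metis mset_subset_eq_add_right)
      with size_reorientation[of zs F el ev] size_enc_list_mset_mono[of D' "snd x" ev] zs Some show ?thesis
        by (simp add: p enc_pair_eq)
    qed simp
    then show ?case
      unfolding add_edges_def by simp
  next
    case 3
    show ?case
      unfolding add_edge_def
      by (rule polytime_intros polytime_pick[OF assms(1)] polytime_explore[OF assms(1)])+
  qed (rule polytime_intros)+
  ultimately have A: "polytime ec (enc_option ?ec) (\<lambda>x. add_edges (E x) (D x))"
    using polytime_comp by fastforce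
  show ?thesis
    unfolding orient_def by (rule polytime_intros polytime_null A)+
qed

section \<open>Window-constrained tomography as an orientation problem\<close>

text \<open>Naming a window by its point list is faithful because windows are nonempty and pairwise
  disjoint, and it needs no numbering of the windows.\<close>

datatype vertex = Row int | Col int | Window "point list"

text \<open>Fixes one direction per window: a single point lies in lines of both kinds and counts as
  horizontal.\<close>

definition horizontal_window :: "window \<Rightarrow> bool" where
  "horizontal_window W \<longleftrightarrow> (\<forall>q\<in>set (points W). snd q = snd (hd (points W)))"

text \<open>A horizontal window takes the place of the row end of its cells, a vertical one that of
  the column end, so that flow always runs from rows to columns.\<close>

definition row_end :: "window list \<Rightarrow> point \<Rightarrow> vertex" where
  "row_end Ws q = foldr (\<lambda>W v. if horizontal_window W \<and> q \<in> set (points W)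
    then Window (points W) else v) Ws (Row (snd q))"

definition col_end :: "window list \<Rightarrow> point \<Rightarrow> vertex" where
  "col_end Ws q = foldr (\<lambda>W v. if \<not> horizontal_window W \<and> q \<in> set (points W)
    then Window (points W) else v) Ws (Col (fst q))"

text \<open>Together with \<open>head_of\<close> the ends of the arc whose flow will equal the
  number of selected points of the window.\<close>

definition tail_of :: "window \<Rightarrow> vertex" where
  "tail_of W = (if horizontal_window W then Row (snd (hd (points W))) else Window (points W))"

definition head_of :: "window \<Rightarrow> vertex" where
  "head_of W = (if horizontal_window W then Window (points W) else Col (fst (hd (points W))))"

text \<open>The bounds are binary numbers, and only their minimum with the length of \<open>L\<close> is written in unary.\<close>

definition truncate_to :: "'a list \<Rightarrow> 'b list \<Rightarrow> 'b list" where
  "truncate_to L ys = drop (length (drop (length L) ys)) ys"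

text \<open>Horner's scheme with lists in place of numbers. Truncation after each doubling keeps the
  intermediate lists polynomial; the entries carry no meaning.\<close>

definition unary :: "'a list \<Rightarrow> nat \<Rightarrow> bool list" where
  "unary L n = foldr (\<lambda>b ys. truncate_to L (ys @ ys @ (if b then [b] else []))) (bits n) []"

definition copies :: "'a list \<Rightarrow> nat \<Rightarrow> 'b \<Rightarrow> 'b list" where
  "copies L n v = map (\<lambda>_. v) (unary L n)"

text \<open>One more than the size of the grid is as good as infinity.\<close>

definition infinity :: "tomography \<Rightarrow> point list" where
  "infinity T = (0, 0) # grid T"

text \<open>Flow on a window arc is split into an obligatory and an optional part
  (\<open>free\<close>), so that \<open>Le\<close>, \<open>Eq\<close> and \<open>Ge\<close> become
  the intervals \<open>[0, k]\<close>, \<open>[k, k]\<close> and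
  \<open>[k, \<infinity>]\<close>.\<close>

definition forced :: "tomography \<Rightarrow> window \<Rightarrow> 'a \<Rightarrow> 'a list" where
  "forced T W v = (if comparison W = Le then [] else copies (infinity T) (bound W) v)"

definition free :: "tomography \<Rightarrow> window \<Rightarrow> 'a \<Rightarrow> 'a list" where
  "free T W v = (if comparison W = Eq then []
    else if comparison W = Le then copies (infinity T) (bound W) v
    else map (\<lambda>_. v) (infinity T))"

type_synonym arc = "(vertex option, vertex) edge"

text \<open>A cell starts with its column end, which means that the point is not selected. The label
  remembers this vertex so that \<open>selected\<close> can detect a reversal.\<close>

definition cell :: "window list \<Rightarrow> point \<Rightarrow> arc" where
  "cell Ws q = (Some (col_end Ws q), col_end Ws q, row_end Ws q)"

text \<open>
  An integral flow with unit arcs is an orientation: an arc from \<open>u\<close> to \<open>v\<close> that carries flow is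
  owned by \<open>u\<close>, an empty one by \<open>v\<close>. Every arc contributes \<open>v\<close> to the demands, so that a vertex owns
  as many edges as demanded iff its outflow equals its inflow. An arc that is forced to carry flow
  is a loop at \<open>u\<close>; the loops at the columns are the sinks.
\<close>

definition edges :: "tomography \<Rightarrow> arc list" where
  "edges T = map (cell (windows T)) (grid T) @
    concat (map (\<lambda>W. free T W (None, head_of W, tail_of W)) (windows T)) @
    concat (map (\<lambda>W. forced T W (None, tail_of W, tail_of W)) (windows T)) @
    concat (map (\<lambda>c. copies (infinity T) (snd c) (None, Col (fst c), Col (fst c))) (vertical T))"

definition demands :: "tomography \<Rightarrow> vertex list" where
  "demands T = map (col_end (windows T)) (grid T) @
    concat (map (\<lambda>W. free T W (head_of W)) (windows T)) @
    concat (map (\<lambda>W. forced T W (head_of W)) (windows T)) @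
    concat (map (\<lambda>c. copies (infinity T) (snd c) (Row (fst c))) (horizontal T))"

definition selected :: "arc list \<Rightarrow> nat list" where
  "selected E = concat (map (\<lambda>e. case fst e of None \<Rightarrow> []
    | Some l \<Rightarrow> [if owner e = l then 0 else 1]) E)"

definition solve :: "tomography \<Rightarrow> nat list option" where
  "solve T = (case orient (edges T) (demands T) of None \<Rightarrow> None | Some E \<Rightarrow> Some (selected E))"

lemma owner_cell [simp]: "owner (cell Ws q) = col_end Ws q" and other_cell [simp]: "other (cell Ws q) = row_end Ws q"
  by (simp_all add: cell_def)

text \<open>Sums stay in the form of weights times \<open>of_bool\<close>, so that the counting
  identities match and linear arithmetic can combine them.\<close>

declare sum_mult_of_bool_eq [simp del] sum_of_bool_mult_eq [simp del] sum_of_bool_eq [simp del]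

lemma length_truncate_to: "length (truncate_to L ys) = min (length L) (length ys)"
  by (simp add: truncate_to_def)

text \<open>Truncating early loses nothing: if the half already fills \<open>L\<close>, then so does
  the whole.\<close>

lemma length_unary: "length (unary L n) = min n (length L)"
proof (induction n rule: less_induct)
  case (less n)
  show ?case
  proof (cases "n = 0")
    case True
    then show ?thesis by (simp add: unary_def bits.simps)
  next
    case False
    have n: "bits n = odd n # bits (n div 2)"
      using False by (simp add: bits.simps[of n])
    have "length (unary L n) = min (length L)
        (2 * length (unary L (n div 2)) + (if odd n then 1 else 0))"
      by (simp add: unary_def n length_truncate_to mult_2)
    also have "length (unary L (n div 2)) = min (n div 2) (length L)"
      using False by (intro less) simp
    finally show ?thesis
      by (cases "even n") (auto elim!: evenE oddE)
  qed
qed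

lemma copies_replicate: "copies L n v = replicate (min n (length L)) v"
  by (simp add: copies_def map_replicate_const length_unary)

definition forced_count :: "tomography \<Rightarrow> window \<Rightarrow> nat" where
  "forced_count T W = (if comparison W = Le then 0 else min (bound W) (length (grid T) + 1))"

definition free_count :: "tomography \<Rightarrow> window \<Rightarrow> nat" where
  "free_count T W = (if comparison W = Eq then 0
    else if comparison W = Le then min (bound W) (length (grid T) + 1) else length (grid T) + 1)"

lemma forced_replicate: "forced T W v = replicate (forced_count T W) v"
  by (simp add: forced_def forced_count_def copies_replicate infinity_def)

lemma free_replicate: "free T W v = replicate (free_count T W) v"
  by (simp add: free_def free_count_def copies_replicate infinity_def map_replicate_const)

section \<open>Reorientations of parallel edges as integral flows\<close>

lemma count_concat_replicate:
  "distinct xs \<Longrightarrow> count (mset (concat (map (\<lambda>i. replicate (c i) (v i)) xs))) z =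
    (\<Sum>i\<in>set xs. c i * of_bool (v i = z))"
  by (induction xs) auto

lemma count_map:
  "distinct xs \<Longrightarrow> count (mset (map v xs)) z = (\<Sum>i\<in>set xs. of_bool (v i = z))"
  by (induction xs) auto

lemma reorientation_append:
  "reorientation (A @ B) F \<longleftrightarrow> (\<exists>A' B'. F = A' @ B' \<and> reorientation A A' \<and> reorientation B B')"
  unfolding reorientation_def list_all2_append1 by (blast dest: list_all2_lengthD[symmetric])

lemma reorientation_loops:
  assumes "reorientation E F" "\<And>e. e \<in> set E \<Longrightarrow> flip e = e"
  shows "F = E"
  using assms unfolding reorientation_def by (induction rule: list_all2_induct) auto

text \<open>\<open>k\<close> is the number of reversed copies; terms are kept on both sides because
  subtraction on \<open>nat\<close> truncates.\<close>

lemma reorientation_replicate: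
  assumes "reorientation (replicate n e) F"
  shows "\<exists>k\<le>n. \<forall>z. count (owners F) z + k * of_bool (owner e = z) =
    n * of_bool (owner e = z) + k * of_bool (other e = z)"
  using assms
proof (induction n arbitrary: F)
  case 0
  then show ?case by (simp add: reorientation_def)
next
  case (Suc n)
  then obtain f G where F: "F = f # G" "f = e \<or> f = flip e" "reorientation (replicate n e) G"
    by (auto simp: reorientation_def list_all2_Cons1)
  from Suc.IH[OF F(3)] obtain k where k: "k \<le> n"
    "\<And>z. count (owners G) z + k * of_bool (owner e = z) = n * of_bool (owner e = z) + k * of_bool (other e = z)"
    by blast
  show ?case
  proof (cases "f = e")
    case True
    have "count (owners F) z + k * of_bool (owner e = z) =
        Suc n * of_bool (owner e = z) + k * of_bool (other e = z)" for z
      using k(2)[of z] True by (auto simp: F(1))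
    with k(1) show ?thesis by (intro exI[of _ k]) auto
  next
    case False
    have "count (owners F) z + Suc k * of_bool (owner e = z) =
        Suc n * of_bool (owner e = z) + Suc k * of_bool (other e = z)" for z
      using k(2)[of z] False F(2) by (auto simp: F(1))
    with k(1) show ?thesis by (intro exI[of _ "Suc k"]) blast
  qed
qed

lemma sum_fun_upd:
  assumes "finite A" "i \<notin> A"
  shows "(\<Sum>j\<in>insert i A. (f(i := k)) j * g j) = k * g i + (\<Sum>j\<in>A. f j * g j)"
proof -
  have "(\<Sum>j\<in>A. (f(i := k)) j * g j) = (\<Sum>j\<in>A. f j * g j)"
    using assms(2) by (intro sum.cong) auto
  with assms show ?thesis by simp
qed

text \<open>\<open>c i\<close> is the capacity of arc \<open>i\<close>, and \<open>f i\<close> the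
  flow that the reorientation puts on it.\<close>

lemma reorientation_concat_replicate:
  assumes "reorientation (concat (map (\<lambda>i. replicate (c i) (e i)) xs)) F" "distinct xs"
  shows "\<exists>f. (\<forall>i\<in>set xs. f i \<le> c i) \<and> (\<forall>z. count (owners F) z +
      (\<Sum>i\<in>set xs. f i * of_bool (owner (e i) = z)) =
      (\<Sum>i\<in>set xs. c i * of_bool (owner (e i) = z)) + (\<Sum>i\<in>set xs. f i * of_bool (other (e i) = z)))"
  using assms
proof (induction xs arbitrary: F)
  case Nil
  then show ?case by (simp add: reorientation_def)
next
  case (Cons i xs)
  then obtain A B where F: "F = A @ B" "reorientation (replicate (c i) (e i)) A"
    "reorientation (concat (map (\<lambda>i. replicate (c i) (e i)) xs)) B"
    by (auto simp: reorientation_append)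
  from Cons.IH[OF F(3)] Cons.prems(2) obtain f where f: "\<forall>i\<in>set xs. f i \<le> c i"
    "\<And>z. count (owners B) z + (\<Sum>i\<in>set xs. f i * of_bool (owner (e i) = z)) =
      (\<Sum>i\<in>set xs. c i * of_bool (owner (e i) = z)) + (\<Sum>i\<in>set xs. f i * of_bool (other (e i) = z))"
    by auto
  from reorientation_replicate[OF F(2)] obtain k where k: "k \<le> c i"
    "\<And>z. count (owners A) z + k * of_bool (owner (e i) = z) =
      c i * of_bool (owner (e i) = z) + k * of_bool (other (e i) = z)"
    by blast
  have i: "i \<notin> set xs" using Cons.prems(2) by simp
  note upd = sum_fun_upd[OF finite_set i, of f k]
  have "count (owners F) z + (\<Sum>j\<in>set (i # xs). (f(i := k)) j * of_bool (owner (e j) = z)) =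
      (\<Sum>j\<in>set (i # xs). c j * of_bool (owner (e j) = z)) +
      (\<Sum>j\<in>set (i # xs). (f(i := k)) j * of_bool (other (e j) = z))" for z
    unfolding list.set upd F(1) sum.insert[OF finite_set i] map_append mset_append count_union
    using f(2)[of z] k(2)[of z] by linarith
  then show ?case
    using f(1) k(1) by (intro exI[of _ "f(i := k)"]) auto
qed

text \<open>Converse direction: a flow within the capacities is realised by reversing
  \<open>f i\<close> of the \<open>c i\<close> copies.\<close>

lemma reorientation_concat_replicate_ex:
  assumes "distinct xs" "\<And>i. i \<in> set xs \<Longrightarrow> f i \<le> c i"
  shows "\<exists>F. reorientation (concat (map (\<lambda>i. replicate (c i) (e i)) xs)) F \<and>
    (\<forall>z. count (owners F) z + (\<Sum>i\<in>set xs. f i * of_bool (owner (e i) = z)) =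
      (\<Sum>i\<in>set xs. c i * of_bool (owner (e i) = z)) + (\<Sum>i\<in>set xs. f i * of_bool (other (e i) = z)))"
  using assms
proof (induction xs)
  case Nil
  then show ?case by (simp add: reorientation_def)
next
  case (Cons i xs)
  then obtain B where B: "reorientation (concat (map (\<lambda>i. replicate (c i) (e i)) xs)) B"
    "\<And>z. count (owners B) z + (\<Sum>i\<in>set xs. f i * of_bool (owner (e i) = z)) =
      (\<Sum>i\<in>set xs. c i * of_bool (owner (e i) = z)) + (\<Sum>i\<in>set xs. f i * of_bool (other (e i) = z))"
    by auto
  have f: "f i \<le> c i" and i: "i \<notin> set xs" using Cons.prems by simp_all
  let ?A = "replicate (f i) (flip (e i)) @ replicate (c i - f i) (e i)"
  have "reorientation (replicate (f i) (e i) @ replicate (c i - f i) (e i)) ?A"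
    unfolding reorientation_append
    by (intro exI conjI refl) (auto simp: reorientation_def list_all2_conv_all_nth)
  then have "reorientation (replicate (c i) (e i)) ?A"
    using f by (simp flip: replicate_add)
  with B(1) have "reorientation (concat (map (\<lambda>i. replicate (c i) (e i)) (i # xs))) (?A @ B)"
    unfolding list.map concat.simps reorientation_append by blast
  moreover have A: "count (owners ?A) z + f i * of_bool (owner (e i) = z) =
      c i * of_bool (owner (e i) = z) + f i * of_bool (other (e i) = z)" for z
    using f by auto
  have "count (owners (?A @ B)) z + (\<Sum>j\<in>set (i # xs). f j * of_bool (owner (e j) = z)) =
      (\<Sum>j\<in>set (i # xs). c j * of_bool (owner (e j) = z)) +
      (\<Sum>j\<in>set (i # xs). f j * of_bool (other (e j) = z))" for z
    unfolding list.set sum.insert[OF finite_set i] map_append[of _ ?A] mset_append count_union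
    using B(2)[of z] A[of z] by linarith
  ultimately show ?case by blast
qed

text \<open>Unit capacities, but the selection must also be recovered from the labels. Distinct ends
  ensure that a reversed cell shows a different owner.\<close>

lemma reorientation_cells:
  assumes "reorientation (map (cell Ws) qs) F" "distinct qs"
    "\<And>q. q \<in> set qs \<Longrightarrow> col_end Ws q \<noteq> row_end Ws q"
  shows "\<exists>s. selected F = map s qs \<and> (\<forall>q\<in>set qs. s q \<le> 1) \<and> (\<forall>z. count (owners F) z +
      (\<Sum>q\<in>set qs. s q * of_bool (col_end Ws q = z)) =
      (\<Sum>q\<in>set qs. of_bool (col_end Ws q = z)) + (\<Sum>q\<in>set qs. s q * of_bool (row_end Ws q = z)))"
  using assms
proof (induction qs arbitrary: F)
  case Nil
  then show ?case by (simp add: reorientation_def selected_def)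
next
  case (Cons q qs)
  then obtain a B where F: "F = a # B" "a = cell Ws q \<or> a = flip (cell Ws q)"
    "reorientation (map (cell Ws) qs) B"
    by (auto simp: reorientation_def list_all2_Cons1)
  from Cons.IH[OF F(3)] Cons.prems obtain s where s: "selected B = map s qs" "\<forall>q\<in>set qs. s q \<le> 1"
    "\<And>z. count (owners B) z + (\<Sum>q\<in>set qs. s q * of_bool (col_end Ws q = z)) =
      (\<Sum>q\<in>set qs. of_bool (col_end Ws q = z)) + (\<Sum>q\<in>set qs. s q * of_bool (row_end Ws q = z))"
    by auto
  define k :: nat where "k = (if a = cell Ws q then 0 else 1)"
  have q: "q \<notin> set qs" using Cons.prems(2) by simp
  note upd = sum_fun_upd[OF finite_set q, of s k]
  have ne: "col_end Ws q \<noteq> row_end Ws q" using Cons.prems(3) by simp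
  have "selected F = k # selected B"
    using F(2) ne by (auto simp: F(1) selected_def cell_def flip_def k_def)
  then have "selected F = map (s(q := k)) (q # qs)"
    using q by (simp add: s(1))
  moreover have "count (owners F) z + (\<Sum>j\<in>set (q # qs). (s(q := k)) j * of_bool (col_end Ws j = z)) =
      (\<Sum>j\<in>set (q # qs). of_bool (col_end Ws j = z)) +
      (\<Sum>j\<in>set (q # qs). (s(q := k)) j * of_bool (row_end Ws j = z))" for z
  proof -
    have "count (owners F) z = of_bool (owner a = z) + count (owners B) z"
      by (simp add: F(1))
    moreover have "of_bool (owner a = z) + k * of_bool (col_end Ws q = z) =
        of_bool (col_end Ws q = z) + k * of_bool (row_end Ws q = z)"
      using F(2) by (auto simp: k_def)
    ultimately show ?thesis
      unfolding list.set upd sum.insert[OF finite_set q] using s(3)[of z] by linarith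
  qed
  moreover have "\<forall>j\<in>set (q # qs). (s(q := k)) j \<le> 1"
    using s(2) by (simp add: k_def)
  ultimately show ?case by blast
qed

lemma reorientation_cells_ex:
  assumes "distinct qs" "\<And>q. q \<in> set qs \<Longrightarrow> s q \<le> 1"
  shows "\<exists>F. reorientation (map (cell Ws) qs) F \<and> (\<forall>z. count (owners F) z +
      (\<Sum>q\<in>set qs. s q * of_bool (col_end Ws q = z)) =
      (\<Sum>q\<in>set qs. of_bool (col_end Ws q = z)) + (\<Sum>q\<in>set qs. s q * of_bool (row_end Ws q = z)))"
proof -
  have "concat (map (\<lambda>q. replicate 1 (cell Ws q)) qs) = map (cell Ws) qs"
    by (induction qs) auto
  with reorientation_concat_replicate_ex[of qs s "\<lambda>_. 1" "cell Ws"] assms show ?thesis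
    by simp
qed

lemma foldr_Window_in:
  assumes "W \<in> set Ws" "P W" "\<And>W'. W' \<in> set Ws \<Longrightarrow> P W' \<Longrightarrow> W' = W"
  shows "foldr (\<lambda>W v. if P W then Window (points W) else v) Ws d = Window (points W)"
proof -
  have "W \<in> set Vs \<Longrightarrow> set Vs \<subseteq> set Ws \<Longrightarrow>
      foldr (\<lambda>W v. if P W then Window (points W) else v) Vs d = Window (points W)" for Vs
    using assms(2,3) by (induction Vs) auto
  with assms(1) show ?thesis by blast
qed

lemma foldr_Window_out:
  "(\<And>W. W \<in> set Ws \<Longrightarrow> \<not> P W) \<Longrightarrow> foldr (\<lambda>W v. if P W then Window (points W) else v) Ws d = d"
  by (induction Ws) auto

lemma selected_append: "selected (A @ B) = selected A @ selected B"
  by (simp add: selected_def)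

lemma selected_unlabelled: "(\<And>e. e \<in> set E \<Longrightarrow> fst e = None) \<Longrightarrow> selected E = []"
  by (simp add: selected_def)

lemma reorientation_labels: "reorientation E F \<Longrightarrow> fst ` set F = fst ` set E"
  unfolding reorientation_def by (induction rule: list_all2_induct) (auto simp: flip_def)

lemma min_eq_iff: "(m :: nat) < N \<Longrightarrow> m = min n N \<longleftrightarrow> m = n"
  by auto

lemma map_of_bij:
  assumes "distinct xs" "length ys = length xs"
  shows "\<exists>s. ys = map s xs"
proof
  let ?s = "\<lambda>a. ys ! inv_into {..<length xs} ((!) xs) a"
  have "inj_on ((!) xs) {..<length xs}"
    using assms(1) by (simp add: inj_on_nth)
  then show "ys = map ?s xs"
    using assms(2) by (intro nth_equalityI) simp_all
qed

lemma sum_nth: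
  assumes "distinct xs"
  shows "(\<Sum>j | j < length xs \<and> P (xs ! j). map s xs ! j) = (\<Sum>a\<in>set xs. (s a :: nat) * of_bool (P a))"
proof -
  have "(\<Sum>j | j < length xs \<and> P (xs ! j). map s xs ! j) =
      (\<Sum>j\<in>{..<length xs}. s (xs ! j) * of_bool (P (xs ! j)))"
    by (rule sum.mono_neutral_cong_left) auto
  also have "\<dots> = (\<Sum>a\<in>set xs. s a * of_bool (P a))"
    by (rule sum.reindex_bij_betw[OF bij_betw_nth[OF assms]]) simp_all
  finally show ?thesis .
qed

section \<open>Correctness of the network for one time step\<close>

locale tomography_in_lines =
  fixes T :: tomography
  assumes valid: "valid_tomography T"
    and in_line: "W \<in> set (windows T) \<Longrightarrow>
      horizontal_window W \<or> (\<forall>q\<in>set (points W). fst q = fst (hd (points W)))"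
    and disjoint: "W \<in> set (windows T) \<Longrightarrow> W' \<in> set (windows T) \<Longrightarrow>
      q \<in> set (points W) \<Longrightarrow> q \<in> set (points W') \<Longrightarrow> W = W'"
    and distinct_windows: "distinct (windows T)"
begin

abbreviation "G \<equiv> set (grid T)"
abbreviation "\<W> \<equiv> set (windows T)"
abbreviation "N \<equiv> length (grid T) + 1"

lemma distinct_grid: "distinct (grid T)"
  using valid by (auto simp: valid_tomography_def grid_def intro!: distinct_product)

lemma distinct_lines: "distinct (horizontal T)" "distinct (vertical T)"
  using valid by (auto simp: valid_tomography_def distinct_map)

lemma points_nonempty: "W \<in> \<W> \<Longrightarrow> points W \<noteq> []"
  using valid by (auto simp: valid_tomography_def)

lemma grid_lines: "q \<in> G \<Longrightarrow> fst q \<in> fst ` set (vertical T) \<and> snd q \<in> fst ` set (horizontal T)"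
  by (force simp: grid_def)

lemma row_end_in:
  "W \<in> \<W> \<Longrightarrow> horizontal_window W \<Longrightarrow> q \<in> set (points W) \<Longrightarrow>
    row_end (windows T) q = Window (points W)"
  unfolding row_end_def by (rule foldr_Window_in) (use disjoint in blast)+

lemma col_end_in:
  "W \<in> \<W> \<Longrightarrow> \<not> horizontal_window W \<Longrightarrow> q \<in> set (points W) \<Longrightarrow>
    col_end (windows T) q = Window (points W)"
  unfolding col_end_def by (rule foldr_Window_in) (use disjoint in blast)+

lemma row_end_out:
  "(\<And>W. W \<in> \<W> \<Longrightarrow> horizontal_window W \<Longrightarrow> q \<notin> set (points W)) \<Longrightarrow>
    row_end (windows T) q = Row (snd q)"
  unfolding row_end_def by (rule foldr_Window_out) auto

lemma col_end_out:
  "(\<And>W. W \<in> \<W> \<Longrightarrow> \<not> horizontal_window W \<Longrightarrow> q \<notin> set (points W)) \<Longrightarrow>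
    col_end (windows T) q = Col (fst q)"
  unfolding col_end_def by (rule foldr_Window_out) auto

text \<open>A common first point already makes two windows equal, by disjointness.\<close>

lemma points_eq_iff: "W \<in> \<W> \<Longrightarrow> W' \<in> \<W> \<Longrightarrow> points W = points W' \<longleftrightarrow> W = W'"
  using disjoint[of W W' "hd (points W)"] points_nonempty[of W] by auto

lemma row_end_eq_Window:
  assumes "W \<in> \<W>"
  shows "row_end (windows T) q = Window (points W) \<longleftrightarrow> horizontal_window W \<and> q \<in> set (points W)"
proof (cases "\<exists>V\<in>\<W>. horizontal_window V \<and> q \<in> set (points V)")
  case True
  then obtain V where V: "V \<in> \<W>" "horizontal_window V" "q \<in> set (points V)" by blast
  then show ?thesis
    using row_end_in[OF V] points_eq_iff[OF V(1) assms] disjoint[OF assms V(1), of q] by auto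
next
  case False
  then have "row_end (windows T) q = Row (snd q)" by (intro row_end_out) blast
  with False assms show ?thesis by auto
qed

lemma col_end_eq_Window:
  assumes "W \<in> \<W>"
  shows "col_end (windows T) q = Window (points W) \<longleftrightarrow> \<not> horizontal_window W \<and> q \<in> set (points W)"
proof (cases "\<exists>V\<in>\<W>. \<not> horizontal_window V \<and> q \<in> set (points V)")
  case True
  then obtain V where V: "V \<in> \<W>" "\<not> horizontal_window V" "q \<in> set (points V)" by blast
  then show ?thesis
    using col_end_in[OF V] points_eq_iff[OF V(1) assms] disjoint[OF assms V(1), of q] by auto
next
  case False
  then have "col_end (windows T) q = Col (fst q)" by (intro col_end_out) blast
  with False assms show ?thesis by auto
qed

text \<open>Both ends could be windows only for a point in a horizontal and in a vertical one, which
  disjointness excludes; otherwise the ends are vertices of different kinds.\<close>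

lemma col_end_neq_row_end: "col_end (windows T) q \<noteq> row_end (windows T) q"
proof (cases "\<exists>W\<in>\<W>. q \<in> set (points W)")
  case True
  then obtain W where W: "W \<in> \<W>" "q \<in> set (points W)" by blast
  have not: "q \<notin> set (points V)" if "V \<in> \<W>" "V \<noteq> W" for V
    using disjoint[OF that(1) W(1), of q] W(2) that(2) by blast
  show ?thesis
  proof (cases "horizontal_window W")
    case True
    then have "col_end (windows T) q = Col (fst q)"
      using not by (intro col_end_out) auto
    with row_end_in[OF W(1) True W(2)] show ?thesis by simp
  next
    case False
    then have "row_end (windows T) q = Row (snd q)"
      using not by (intro row_end_out) auto
    with col_end_in[OF W(1) False W(2)] show ?thesis by simp
  qed
next
  case False
  then have "row_end (windows T) q = Row (snd q)" "col_end (windows T) q = Col (fst q)"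
    by (intro row_end_out col_end_out; blast)+
  then show ?thesis by simp
qed

lemma sum_windows_in:
  assumes "W \<in> \<W>" "q \<in> set (points W)"
  shows "(\<Sum>V\<in>\<W>. of_bool (q \<in> set (points V)) * h V) = (h W :: nat)"
proof -
  have "(\<Sum>V\<in>\<W>. of_bool (q \<in> set (points V)) * h V) = (\<Sum>V\<in>{W}. h V)"
  proof (rule sum.mono_neutral_cong_right)
    have "q \<notin> set (points V)" if "V \<in> \<W> - {W}" for V
      using disjoint[OF _ assms(1) _ assms(2)] that by blast
    then show "\<forall>V\<in>\<W> - {W}. of_bool (q \<in> set (points V)) * h V = 0"
      by simp
  qed (use assms in simp_all)
  then show ?thesis by simp
qed

text \<open>Passing through its window, every selected cell is an arc from its row to its column.\<close>

lemma cell_balance: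
  "of_bool (row_end (windows T) q = z) + (\<Sum>W\<in>\<W>. of_bool (q \<in> set (points W)) * of_bool (tail_of W = z)) +
      of_bool (Col (fst q) = z) =
    of_bool (col_end (windows T) q = z) + (\<Sum>W\<in>\<W>. of_bool (q \<in> set (points W)) * of_bool (head_of W = z)) +
      (of_bool (Row (snd q) = z) :: nat)"
proof (cases "\<exists>W\<in>\<W>. q \<in> set (points W)")
  case True
  then obtain W where W: "W \<in> \<W>" "q \<in> set (points W)" by blast
  have not: "q \<notin> set (points V)" if "V \<in> \<W>" "V \<noteq> W" for V
    using disjoint[OF that(1) W(1), of q] W(2) that(2) by blast
  show ?thesis
  proof (cases "horizontal_window W")
    case True
    then have "col_end (windows T) q = Col (fst q)"
      using not by (intro col_end_out) auto
    moreover have "tail_of W = Row (snd q)" "head_of W = Window (points W)"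
      using True W(2) by (simp_all add: tail_of_def head_of_def horizontal_window_def)
    ultimately show ?thesis
      unfolding sum_windows_in[OF W] row_end_in[OF W(1) True W(2)] by simp
  next
    case False
    then have "row_end (windows T) q = Row (snd q)"
      using not by (intro row_end_out) auto
    moreover have "tail_of W = Window (points W)" "head_of W = Col (fst q)"
      using False W in_line[OF W(1)] by (auto simp: tail_of_def head_of_def)
    ultimately show ?thesis
      unfolding sum_windows_in[OF W] col_end_in[OF W(1) False W(2)] by simp
  qed
next
  case False
  then have zero: "(\<Sum>W\<in>\<W>. of_bool (q \<in> set (points W)) * h W) = (0 :: nat)" for h
    by (intro sum.neutral) auto
  have "row_end (windows T) q = Row (snd q)" "col_end (windows T) q = Col (fst q)"
    using False by (intro row_end_out col_end_out; blast)+
  then show ?thesis unfolding zero by simp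
qed

definition sinks :: "vertex \<Rightarrow> nat" where
  "sinks z = (\<Sum>c\<in>set (vertical T). min (snd c) N * of_bool (Col (fst c) = z))"

definition sources :: "vertex \<Rightarrow> nat" where
  "sources z = (\<Sum>c\<in>set (horizontal T). min (snd c) N * of_bool (Row (fst c) = z))"

text \<open>Flow conservation at \<open>z\<close>, outflow on the left and inflow on the right, for
  flow \<open>s\<close> on the cells and \<open>g\<close> on the window arcs.\<close>

definition balanced :: "(point \<Rightarrow> nat) \<Rightarrow> (window \<Rightarrow> nat) \<Rightarrow> vertex \<Rightarrow> bool" where
  "balanced s g z \<longleftrightarrow>
    (\<Sum>q\<in>G. s q * of_bool (row_end (windows T) q = z)) + (\<Sum>W\<in>\<W>. g W * of_bool (tail_of W = z)) + sinks z =
    (\<Sum>q\<in>G. s q * of_bool (col_end (windows T) q = z)) + (\<Sum>W\<in>\<W>. g W * of_bool (head_of W = z)) + sources z"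

definition load :: "(point \<Rightarrow> nat) \<Rightarrow> window \<Rightarrow> nat" where
  "load s W = (\<Sum>q\<in>G. s q * of_bool (q \<in> set (points W)))"

lemma sum_load:
  "(\<Sum>W\<in>\<W>. load s W * h W) = (\<Sum>q\<in>G. s q * (\<Sum>W\<in>\<W>. of_bool (q \<in> set (points W)) * h W))"
  unfolding load_def sum_distrib_right sum_distrib_left by (subst sum.swap) (simp add: mult.assoc)

text \<open>Weighting \<open>cell_balance\<close> by \<open>s\<close> and summing contracts the
  window vertices; only flow from rows to columns is left.\<close>

lemma balanced_load:
  "balanced s (load s) z \<longleftrightarrow>
    (\<Sum>q\<in>G. s q * of_bool (Row (snd q) = z)) + sinks z = (\<Sum>q\<in>G. s q * of_bool (Col (fst q) = z)) + sources z"
proof -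
  have "(\<Sum>q\<in>G. s q * (of_bool (row_end (windows T) q = z) +
        (\<Sum>W\<in>\<W>. of_bool (q \<in> set (points W)) * of_bool (tail_of W = z)) + of_bool (Col (fst q) = z))) =
      (\<Sum>q\<in>G. s q * (of_bool (col_end (windows T) q = z) +
        (\<Sum>W\<in>\<W>. of_bool (q \<in> set (points W)) * of_bool (head_of W = z)) + of_bool (Row (snd q) = z)))"
    unfolding cell_balance ..
  then show ?thesis
    unfolding balanced_def sum_load distrib_left sum.distrib by linarith
qed

text \<open>At a window vertex one side of the conservation law is the window arc alone and the
  other side its selected cells.\<close>

lemma balanced_imp_load:
  assumes "\<And>z. balanced s g z" "W \<in> \<W>"
  shows "g W = load s W"
proof -
  let ?z = "Window (points W)"
  have pick: "(\<Sum>V\<in>\<W>. g V * of_bool (V = W)) = g W"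
  proof -
    have "(\<Sum>V\<in>\<W>. g V * of_bool (V = W)) = (\<Sum>V\<in>{W}. g V)"
      by (rule sum.mono_neutral_cong_right) (use assms(2) in auto)
    then show ?thesis by simp
  qed
  have tail: "tail_of V = ?z \<longleftrightarrow> \<not> horizontal_window W \<and> V = W"
    and head: "head_of V = ?z \<longleftrightarrow> horizontal_window W \<and> V = W" if "V \<in> \<W>" for V
    using points_eq_iff[OF that assms(2)] by (auto simp: tail_of_def head_of_def)
  have 1: "sinks ?z = 0" "sources ?z = 0"
    by (simp_all add: sinks_def sources_def)
  have 2: "(\<Sum>V\<in>\<W>. g V * of_bool (tail_of V = ?z)) = of_bool (\<not> horizontal_window W) * g W"
    "(\<Sum>V\<in>\<W>. g V * of_bool (head_of V = ?z)) = of_bool (horizontal_window W) * g W"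
    using pick by (simp_all add: tail head of_bool_conj sum_distrib_left[symmetric] cong: sum.cong)
  have 3: "(\<Sum>q\<in>G. s q * of_bool (row_end (windows T) q = ?z)) = of_bool (horizontal_window W) * load s W"
    "(\<Sum>q\<in>G. s q * of_bool (col_end (windows T) q = ?z)) = of_bool (\<not> horizontal_window W) * load s W"
    by (simp_all add: row_end_eq_Window[OF assms(2)] col_end_eq_Window[OF assms(2)] load_def)
  show ?thesis
    using assms(1)[of ?z] unfolding balanced_def 1 2 3 by (cases "horizontal_window W") simp_all
qed

lemma sinks_Row: "sinks (Row y) = 0" and sources_Col: "sources (Col x) = 0"
  by (simp_all add: sinks_def sources_def)

lemma sinks_Col: "(x, n) \<in> set (vertical T) \<Longrightarrow> sinks (Col x) = min n N"
  and sources_Row: "(y, n) \<in> set (horizontal T) \<Longrightarrow> sources (Row y) = min n N"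
proof -
  have *: "(\<Sum>c\<in>set L. min (snd c) N * of_bool (fst c = a)) = min n N"
    if "(a, n) \<in> set L" "distinct (map fst L)" for a :: int and n L
  proof -
    have "(\<Sum>c\<in>set L. min (snd c) N * of_bool (fst c = a)) = (\<Sum>c\<in>{(a, n)}. min (snd c) N)"
      by (rule sum.mono_neutral_cong_right) (use that eq_key_imp_eq_value in force)+
    then show ?thesis by simp
  qed
  show "(x, n) \<in> set (vertical T) \<Longrightarrow> sinks (Col x) = min n N"
    unfolding sinks_def vertex.inject by (rule *) (use valid in \<open>auto simp: valid_tomography_def\<close>)
  show "(y, n) \<in> set (horizontal T) \<Longrightarrow> sources (Row y) = min n N"
    unfolding sources_def vertex.inject by (rule *) (use valid in \<open>auto simp: valid_tomography_def\<close>)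
qed

text \<open>Conservation is also required at window vertices and at lines outside the support; there
  all sums vanish, since grid points lie on listed lines.\<close>

lemma balanced_load_iff:
  "(\<forall>z. balanced s (load s) z) \<longleftrightarrow>
    (\<forall>(y, n)\<in>set (horizontal T). (\<Sum>q\<in>G. s q * of_bool (snd q = y)) = min n N) \<and>
    (\<forall>(x, n)\<in>set (vertical T). (\<Sum>q\<in>G. s q * of_bool (fst q = x)) = min n N)"
    (is "?L \<longleftrightarrow> ?H \<and> ?V")
proof
  assume ?L
  then have "balanced s (load s) (Row y)" "balanced s (load s) (Col x)" for x y by blast+
  then have "(\<Sum>q\<in>G. s q * of_bool (snd q = y)) = sources (Row y)"
    "(\<Sum>q\<in>G. s q * of_bool (fst q = x)) = sinks (Col x)" for x y
    by (simp_all add: balanced_load sinks_Row sources_Col)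
  then show "?H \<and> ?V"
    by (auto simp: sources_Row sinks_Col)
next
  assume R: "?H \<and> ?V"
  show ?L
  proof
    fix z
    show "balanced s (load s) z"
    proof (cases z)
      case (Row y)
      have "(\<Sum>q\<in>G. s q * of_bool (snd q = y)) = sources (Row y)"
      proof (cases "y \<in> fst ` set (horizontal T)")
        case True
        then show ?thesis using R by (fastforce simp: sources_Row)
      next
        case False
        then have "q \<in> G \<Longrightarrow> snd q \<noteq> y" "c \<in> set (horizontal T) \<Longrightarrow> fst c \<noteq> y" for q c
          using grid_lines[of q] by (blast, force)
        then show ?thesis by (simp add: sources_def)
      qed
      then show ?thesis by (simp add: balanced_load Row sinks_Row)
    next
      case (Col x)
      have "(\<Sum>q\<in>G. s q * of_bool (fst q = x)) = sinks (Col x)"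
      proof (cases "x \<in> fst ` set (vertical T)")
        case True
        then show ?thesis using R by (fastforce simp: sinks_Col)
      next
        case False
        then have "q \<in> G \<Longrightarrow> fst q \<noteq> x" "c \<in> set (vertical T) \<Longrightarrow> fst c \<noteq> x" for q c
          using grid_lines[of q] by (blast, force)
        then show ?thesis by (simp add: sinks_def)
      qed
      then show ?thesis by (simp add: balanced_load Col sources_Col)
    next
      case (Window w)
      then show ?thesis by (simp add: balanced_load sinks_def sources_def)
    qed
  qed
qed

text \<open>No sum over selected points reaches the truncation value \<open>N\<close>. Hence a
  number is attained iff its truncation is, and an oversized one stays unattainable; truncation at
  \<open>length (grid T)\<close> itself would make it attainable.\<close>

lemma ilp_solution_iff:
  assumes s: "\<And>q. q \<in> G \<Longrightarrow> s q \<le> 1"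
  shows "ilp_solution T (map s (grid T)) \<longleftrightarrow> (\<forall>z. balanced s (load s) z) \<and>
    (\<forall>W\<in>\<W>. forced_count T W \<le> load s W \<and> load s W \<le> forced_count T W + free_count T W)"
proof -
  have small: "(\<Sum>q\<in>G. s q * of_bool (P q)) < N" for P
  proof -
    have "s q * of_bool (P q) \<le> 1" if "q \<in> G" for q
      using s[OF that] by (cases "P q") simp_all
    then have "(\<Sum>q\<in>G. s q * of_bool (P q)) \<le> of_nat (card G) * 1"
      by (rule sum_bounded_above)
    then show ?thesis using distinct_card[OF distinct_grid] by simp
  qed
  have "set (map s (grid T)) \<subseteq> {0, 1}"
    using s by (force simp: le_Suc_eq)
  moreover have "xray_constraints T (map s (grid T)) \<longleftrightarrow> (\<forall>z. balanced s (load s) z)"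
    unfolding xray_constraints_def balanced_load_iff sum_nth[OF distinct_grid, where P = "\<lambda>q. snd q = _"]
      sum_nth[OF distinct_grid, where P = "\<lambda>q. fst q = _"]
    by (simp only: min_eq_iff[OF small])
  moreover have "window_constraints T (map s (grid T)) \<longleftrightarrow>
    (\<forall>W\<in>\<W>. forced_count T W \<le> load s W \<and> load s W \<le> forced_count T W + free_count T W)"
  proof -
    have 1: "(\<Sum>j\<in>window_indices T i. map s (grid T) ! j) = load s (windows T ! i)" for i
      unfolding window_indices_def load_def by (rule sum_nth[OF distinct_grid])
    have L: "load s W < N" for W
      unfolding load_def by (rule small)
    have 2: "compares (comparison W) (load s W) (bound W) \<longleftrightarrow>
        forced_count T W \<le> load s W \<and> load s W \<le> forced_count T W + free_count T W" for W
      using L[of W] by (cases "comparison W"; simp add: forced_count_def free_count_def min_def; arith)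
    show ?thesis
      unfolding window_constraints_def 1 2 by (simp add: all_set_conv_all_nth)
  qed
  ultimately show ?thesis
    by (simp add: ilp_solution_def)
qed

lemma count_demands:
  "count (mset (demands T)) z = (\<Sum>q\<in>G. of_bool (col_end (windows T) q = z)) +
    (\<Sum>W\<in>\<W>. free_count T W * of_bool (head_of W = z)) +
    (\<Sum>W\<in>\<W>. forced_count T W * of_bool (head_of W = z)) + sources z"
  unfolding demands_def free_replicate forced_replicate copies_replicate mset_append count_union
    count_map[OF distinct_grid] count_concat_replicate[OF distinct_windows]
    count_concat_replicate[OF distinct_lines(1)] sources_def
  by (simp add: infinity_def)

lemma solve_Some:
  assumes "solve T = Some x"
  shows "ilp_solution T x"
proof -
  obtain E where E: "orient (edges T) (demands T) = Some E" "x = selected E"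
    using assms by (auto simp: solve_def split: option.splits)
  let ?B = "concat (map (\<lambda>W. replicate (free_count T W) (None, head_of W, tail_of W)) (windows T)) :: arc list"
  let ?C = "concat (map (\<lambda>W. replicate (forced_count T W) (None, tail_of W, tail_of W)) (windows T)) :: arc list"
  let ?D = "concat (map (\<lambda>c. replicate (min (snd c) N) (None, Col (fst c), Col (fst c))) (vertical T)) :: arc list"
  have edges: "edges T = map (cell (windows T)) (grid T) @ ?B @ ?C @ ?D"
    by (simp add: edges_def free_replicate forced_replicate copies_replicate infinity_def)
  from orient_Some(1)[OF E(1)] obtain A B C D where F: "E = A @ B @ C @ D"
    "reorientation (map (cell (windows T)) (grid T)) A" "reorientation ?B B"
    "reorientation ?C C" "reorientation ?D D"
    unfolding edges reorientation_append by blast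
  \<comment> \<open>Forced arcs and sinks are loops, so they look the same in every
    orientation.\<close>
  have CD: "C = ?C" "D = ?D"
    using F(4,5) by (auto intro!: reorientation_loops simp: flip_def)
  from reorientation_cells[OF F(2) distinct_grid col_end_neq_row_end] obtain s where
    s: "selected A = map s (grid T)" "\<forall>q\<in>G. s q \<le> 1"
    "\<And>z. count (owners A) z + (\<Sum>q\<in>G. s q * of_bool (col_end (windows T) q = z)) =
      (\<Sum>q\<in>G. of_bool (col_end (windows T) q = z)) + (\<Sum>q\<in>G. s q * of_bool (row_end (windows T) q = z))"
    by blast
  from reorientation_concat_replicate[OF F(3) distinct_windows] obtain f where
    f: "\<forall>W\<in>\<W>. f W \<le> free_count T W"
    "\<And>z. count (owners B) z + (\<Sum>W\<in>\<W>. f W * of_bool (head_of W = z)) =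
      (\<Sum>W\<in>\<W>. free_count T W * of_bool (head_of W = z)) + (\<Sum>W\<in>\<W>. f W * of_bool (tail_of W = z))"
    by auto
  have C: "count (owners C) z = (\<Sum>W\<in>\<W>. forced_count T W * of_bool (tail_of W = z))" for z
    using count_concat_replicate[OF distinct_windows, of "forced_count T" tail_of z]
    by (simp add: CD map_concat comp_def)
  have D: "count (owners D) z = sinks z" for z
    using count_concat_replicate[OF distinct_lines(2), of "\<lambda>c. min (snd c) N" "\<lambda>c. Col (fst c)" z]
    by (simp add: CD map_concat comp_def sinks_def)
  \<comment> \<open>The total flow on a window arc: forced units are fixed in advance, and
    \<open>f\<close> counts the optional ones.\<close>
  let ?g = "\<lambda>W. forced_count T W + f W"
  have bal: "balanced s ?g z" for z
  proof -
    have "count (owners A) z + count (owners B) z + count (owners C) z + count (owners D) z =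
        count (mset (demands T)) z"
      unfolding orient_Some(2)[OF E(1), symmetric] F(1) by simp
    with s(3)[of z] f(2)[of z] show ?thesis
      unfolding balanced_def count_demands C D distrib_right sum.distrib by linarith
  qed
  have load: "?g W = load s W" if "W \<in> \<W>" for W
    by (rule balanced_imp_load[OF bal that])
  have "balanced s (load s) z" for z
    using bal[of z] load unfolding balanced_def by (simp cong: sum.cong)
  moreover have "forced_count T W \<le> load s W \<and> load s W \<le> forced_count T W + free_count T W"
    if "W \<in> \<W>" for W
    using load[OF that] f(1) that by (auto simp flip: load)
  ultimately have "ilp_solution T (map s (grid T))"
    using s(2) by (subst ilp_solution_iff) auto
  \<comment> \<open>Window and sink edges carry no label, so they contribute no entries to the
    solution vector.\<close>
  moreover have "selected (B @ C @ D) = []"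
  proof (rule selected_unlabelled)
    have "fst ` set (B @ C @ D) = fst ` set (?B @ ?C @ ?D)"
      using reorientation_labels[OF F(3)] reorientation_labels[OF F(4)] reorientation_labels[OF F(5)]
      by (simp only: set_append image_Un)
    also have "\<dots> \<subseteq> {None}" by auto
    finally show "fst e = None" if "e \<in> set (B @ C @ D)" for e
      using that by blast
  qed
  ultimately show ?thesis
    using s(1) by (simp add: E(2) F(1) selected_append)
qed

lemma solve_None:
  assumes "solve T = None"
  shows "\<not> ilp_solution T x"
proof
  assume x: "ilp_solution T x"
  have orient: "orient (edges T) (demands T) = None"
    using assms by (auto simp: solve_def split: option.splits)
  obtain s where s: "x = map s (grid T)"
    using map_of_bij[OF distinct_grid, of x] x by (auto simp: ilp_solution_def)
  have s1: "s q \<le> 1" if "q \<in> G" for q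
    using x that unfolding ilp_solution_def s by auto
  have sol: "(\<forall>z. balanced s (load s) z) \<and>
    (\<forall>W\<in>\<W>. forced_count T W \<le> load s W \<and> load s W \<le> forced_count T W + free_count T W)"
    using x ilp_solution_iff[of s] s1 unfolding s by blast
  then have bal: "balanced s (load s) z" for z
    by blast
  have bd: "forced_count T W \<le> load s W \<and> load s W \<le> forced_count T W + free_count T W"
    if "W \<in> \<W>" for W
    using sol that by blast
  \<comment> \<open>The subtraction is exact, because \<open>bd\<close> bounds the load from
    below.\<close>
  let ?f = "\<lambda>W. load s W - forced_count T W"
  let ?B = "concat (map (\<lambda>W. replicate (free_count T W) (None, head_of W, tail_of W)) (windows T)) :: arc list"
  let ?C = "concat (map (\<lambda>W. replicate (forced_count T W) (None, tail_of W, tail_of W)) (windows T)) :: arc list"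
  let ?D = "concat (map (\<lambda>c. replicate (min (snd c) N) (None, Col (fst c), Col (fst c))) (vertical T)) :: arc list"
  have edges: "edges T = map (cell (windows T)) (grid T) @ ?B @ ?C @ ?D"
    by (simp add: edges_def free_replicate forced_replicate copies_replicate infinity_def)
  obtain A where A: "reorientation (map (cell (windows T)) (grid T)) A"
    "\<And>z. count (owners A) z + (\<Sum>q\<in>G. s q * of_bool (col_end (windows T) q = z)) =
      (\<Sum>q\<in>G. of_bool (col_end (windows T) q = z)) + (\<Sum>q\<in>G. s q * of_bool (row_end (windows T) q = z))"
    using reorientation_cells_ex[OF distinct_grid, of s] s1 by blast
  have "?f W \<le> free_count T W" if "W \<in> \<W>" for W
    using bd[OF that] by linarith
  with reorientation_concat_replicate_ex[OF distinct_windows, where f = ?f and c = "free_count T"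
      and e = "\<lambda>W. (None, head_of W, tail_of W) :: arc"]
  obtain B where B: "reorientation ?B B"
    "\<And>z. count (owners B) z + (\<Sum>W\<in>\<W>. ?f W * of_bool (head_of W = z)) =
      (\<Sum>W\<in>\<W>. free_count T W * of_bool (head_of W = z)) + (\<Sum>W\<in>\<W>. ?f W * of_bool (tail_of W = z))"
    unfolding fst_conv snd_conv by blast
  have refl: "reorientation E E" for E :: "arc list"
    by (simp add: reorientation_def list_all2_refl)
  have "reorientation (edges T) (A @ B @ ?C @ ?D)"
    unfolding edges reorientation_append using A(1) B(1) refl by blast
  moreover have "owners (A @ B @ ?C @ ?D) = mset (demands T)"
  proof (rule multiset_eqI)
    fix z
    have C: "count (owners ?C) z = (\<Sum>W\<in>\<W>. forced_count T W * of_bool (tail_of W = z))"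
      using count_concat_replicate[OF distinct_windows, of "forced_count T" tail_of z]
      by (simp add: map_concat comp_def)
    have D: "count (owners ?D) z = sinks z"
      using count_concat_replicate[OF distinct_lines(2), of "\<lambda>c. min (snd c) N" "\<lambda>c. Col (fst c)" z]
      by (simp add: map_concat comp_def sinks_def)
    have load: "(\<Sum>W\<in>\<W>. load s W * h W) = (\<Sum>W\<in>\<W>. ?f W * h W) + (\<Sum>W\<in>\<W>. forced_count T W * h W)" for h
      unfolding sum.distrib[symmetric] distrib_right[symmetric] using bd by (intro sum.cong) auto
    have "count (owners (A @ B @ ?C @ ?D)) z =
        count (owners A) z + count (owners B) z + count (owners ?C) z + count (owners ?D) z"
      unfolding map_append mset_append count_union by simp
    then show "count (owners (A @ B @ ?C @ ?D)) z = count (mset (demands T)) z"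
      using A(2)[of z] B(2)[of z] bal[of z]
      unfolding balanced_def count_demands C D load by linarith
  qed
  ultimately show False
    using orient_None[OF orient] by blast
qed

end

section \<open>The reduction in polynomial time\<close>

lemma inj_enc_pair:
  assumes "inj e1" "inj e2"
  shows "inj (enc_pair e1 e2)"
  using assms by (auto simp: inj_def)

lemma inj_enc_list:
  assumes "inj e"
  shows "inj (enc_list e)"
proof (rule injI)
  show "enc_list e xs = enc_list e ys \<Longrightarrow> xs = ys" for xs ys
  proof (induction xs arbitrary: ys)
    case Nil
    then show ?case by (cases ys) auto
  next
    case (Cons x xs)
    then show ?case by (cases ys) (auto simp: inj_eq[OF assms])
  qed
qed

text \<open>Decoding by Horner's scheme shows that \<open>bits\<close> is injective.\<close>

lemma foldr_bits: "foldr (\<lambda>b n. of_bool b + 2 * n) (bits n) 0 = n"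
proof (induction n rule: less_induct)
  case (less n)
  then show ?case
    by (cases "n = 0") (simp_all add: bits.simps[of n] bits.simps[of 0])
qed

lemma inj_enc_bool: "inj enc_bool"
  by (auto simp: inj_def enc_bool_def)

lemma inj_enc_nat: "inj enc_nat"
proof (rule injI)
  fix m n
  assume "enc_nat m = enc_nat n"
  then have "bits m = bits n"
    unfolding enc_nat_def using inj_enc_list[OF inj_enc_bool] by (simp add: inj_eq)
  then show "m = n" by (metis foldr_bits)
qed

lemma inj_enc_int: "inj enc_int"
proof (rule injI)
  fix a b
  assume "enc_int a = enc_int b"
  then have "(a < 0) = (b < 0)" "nat \<bar>a\<bar> = nat \<bar>b\<bar>"
    by (simp_all add: enc_int_def inj_eq[OF inj_enc_nat] inj_eq[OF inj_enc_bool])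
  then show "a = b" by linarith
qed

lemma inj_enc_comparison: "inj enc_comparison"
  unfolding inj_def by (metis (full_types) comparison.exhaust data.distinct(1) data.inject enc_comparison.simps)

abbreviation enc_point :: "point \<Rightarrow> data" where
  "enc_point \<equiv> enc_pair enc_int enc_int"

fun enc_vertex :: "vertex \<Rightarrow> data" where
  "enc_vertex (Row y) = Node Leaf (enc_int y)"
| "enc_vertex (Col x) = Node (Node Leaf Leaf) (enc_int x)"
| "enc_vertex (Window ps) = Node (Node Leaf (Node Leaf Leaf)) (enc_list enc_point ps)"

lemma inj_enc_vertex: "inj enc_vertex"
proof (rule injI)
  show "enc_vertex u = enc_vertex v \<Longrightarrow> u = v" for u v
    by (cases u; cases v)
      (auto simp: inj_eq[OF inj_enc_int] inj_eq[OF inj_enc_list[OF inj_enc_pair[OF inj_enc_int inj_enc_int]]])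
qed

lemma polytime_Row [polytime_intros]:
  "polytime ec enc_int f \<Longrightarrow> polytime ec enc_vertex (\<lambda>x. Row (f x))"
  unfolding polytime_def by (simp add: computable_Node computable_const)

lemma polytime_Col [polytime_intros]:
  "polytime ec enc_int f \<Longrightarrow> polytime ec enc_vertex (\<lambda>x. Col (f x))"
  unfolding polytime_def by (simp add: computable_Node computable_const)

lemma polytime_Window [polytime_intros]:
  "polytime ec (enc_list enc_point) f \<Longrightarrow> polytime ec enc_vertex (\<lambda>x. Window (f x))"
  unfolding polytime_def by (simp add: computable_Node computable_const)

lemma polytime_points [polytime_intros]:
  "polytime ec enc_window f \<Longrightarrow> polytime ec (enc_list enc_point) (\<lambda>x. points (f x))"
  unfolding polytime_def enc_window_def by (drule computable_left) simp

lemma polytime_comparison [polytime_intros]: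
  "polytime ec enc_window f \<Longrightarrow> polytime ec enc_comparison (\<lambda>x. comparison (f x))"
  unfolding polytime_def enc_window_def by (drule computable_right, drule computable_left) simp

lemma polytime_bound [polytime_intros]:
  "polytime ec enc_window f \<Longrightarrow> polytime ec enc_nat (\<lambda>x. bound (f x))"
  unfolding polytime_def enc_window_def by (drule computable_right, drule computable_right) simp

lemma polytime_horizontal [polytime_intros]:
  "polytime ec enc_tomography f \<Longrightarrow>
    polytime ec (enc_list (enc_pair enc_int enc_nat)) (\<lambda>x. horizontal (f x))"
  unfolding polytime_def enc_tomography_def by (drule computable_left) simp

lemma polytime_vertical [polytime_intros]:
  "polytime ec enc_tomography f \<Longrightarrow>
    polytime ec (enc_list (enc_pair enc_int enc_nat)) (\<lambda>x. vertical (f x))"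
  unfolding polytime_def enc_tomography_def by (drule computable_right, drule computable_left) simp

lemma polytime_windows [polytime_intros]:
  "polytime ec enc_tomography f \<Longrightarrow> polytime ec (enc_list enc_window) (\<lambda>x. windows (f x))"
  unfolding polytime_def enc_tomography_def by (drule computable_right, drule computable_right) simp

lemma polytime_bits [polytime_intros]:
  "polytime ec enc_nat f \<Longrightarrow> polytime ec (enc_list enc_bool) (\<lambda>x. bits (f x))"
  unfolding polytime_def enc_nat_def .

lemma polytime_comp2:
  assumes "polytime (enc_pair e1 e2) e (\<lambda>p. F (fst p) (snd p))" "polytime ec e1 f" "polytime ec e2 g"
  shows "polytime ec e (\<lambda>x. F (f x) (g x))"
  using polytime_comp[OF polytime_Pair[OF assms(2,3)] assms(1)] by simp

lemma polytime_hd [polytime_intros]: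
  assumes "polytime ec (enc_list e) f"
  shows "polytime ec e (\<lambda>x. hd (f x))"
  unfolding hd_def by (rule polytime_intros assms)+

lemma polytime_tl [polytime_intros]:
  assumes "polytime ec (enc_list e) f"
  shows "polytime ec (enc_list e) (\<lambda>x. tl (f x))"
proof -
  have "polytime ec (enc_list e) (\<lambda>x. case f x of [] \<Rightarrow> [] | a # as \<Rightarrow> as)"
    by (rule polytime_intros assms)+
  then show ?thesis by (simp add: tl_def)
qed

lemma foldr_tl: "foldr (\<lambda>_. tl) ys xs = drop (length ys) xs"
  by (induction ys) (simp_all add: drop_Suc tl_drop)

lemma polytime_drop [polytime_intros]:
  assumes "polytime ec (enc_list e1) f" "polytime ec (enc_list e2) g"
  shows "polytime ec (enc_list e2) (\<lambda>x. drop (length (f x)) (g x))"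
  unfolding foldr_tl[symmetric]
proof (rule polytime_foldr_additive[OF assms, where r = 0])
  show "size (enc_list e2 (tl b)) \<le> size (enc_list e2 b) + poly 0 (size (e1 a) + size (ec x))" for x a b
    by (cases b) simp_all
qed (rule polytime_intros)+

lemma polytime_unary:
  assumes "polytime ec (enc_list e) L" "polytime ec enc_nat n"
  shows "polytime ec (enc_list enc_bool) (\<lambda>x. unary (L x) (n x))"
proof (rule polytime_comp2[OF _ assms])
  show "polytime (enc_pair (enc_list e) enc_nat) (enc_list enc_bool) (\<lambda>p. unary (fst p) (snd p))"
    unfolding unary_def
  proof (rule polytime_foldr[where ea = enc_bool and q = "[:0, 2:]"], goal_cases)
    case (4 x us zs)
    let ?ys = "foldr (\<lambda>b ys. truncate_to (fst x) (ys @ ys @ (if b then [b] else []))) zs []"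
    have "length ?ys \<le> length (fst x)"
      by (cases zs) (simp_all add: length_truncate_to)
    moreover have "size (enc_list enc_bool ?ys) \<le> length ?ys * (Suc 0 + 1)"
      by (rule size_enc_list_le) (rule size_enc_bool)
    moreover have "length (fst x) \<le> size (enc_pair (enc_list e) enc_nat x)"
      using length_le_size_enc_list[of "fst x" e] by (simp add: enc_pair_eq)
    ultimately show ?case by simp
  qed (unfold truncate_to_def, (rule polytime_intros)+)
qed

lemma polytime_copies [polytime_intros]:
  assumes "polytime ec (enc_list e) L" "polytime ec enc_nat n" "polytime ec ev v"
  shows "polytime ec (enc_list ev) (\<lambda>x. copies (L x) (n x) (v x))"
  unfolding copies_def
  by (rule polytime_map[OF polytime_unary[OF assms(1,2)]])
    (rule polytime_comp[OF polytime_snd[OF polytime_var] assms(3)])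

lemmas polytime_int_eq [polytime_intros] = polytime_eq[OF inj_enc_int]
lemmas polytime_point_member [polytime_intros] = polytime_member[OF inj_enc_pair[OF inj_enc_int inj_enc_int]]
lemmas polytime_comparison_eq [polytime_intros] = polytime_eq[OF inj_enc_comparison]
lemmas polytime_vertex_eq [polytime_intros] = polytime_eq[OF inj_enc_vertex]

lemma polytime_horizontal_window [polytime_intros]:
  "polytime ec enc_window f \<Longrightarrow> polytime ec enc_bool (\<lambda>x. horizontal_window (f x))"
proof (erule polytime_comp)
  show "polytime enc_window enc_bool horizontal_window"
    unfolding horizontal_window_def by (rule polytime_intros)+
qed

lemma size_Window_points: "size (enc_vertex (Window (points W))) \<le> size (enc_window W) + 3"
  by (simp add: enc_window_def)

lemma polytime_row_end [polytime_intros]: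
  assumes "polytime ec (enc_list enc_window) f" "polytime ec enc_point g"
  shows "polytime ec enc_vertex (\<lambda>x. row_end (f x) (g x))"
proof (rule polytime_comp2[OF _ assms])
  show "polytime (enc_pair (enc_list enc_window) enc_point) enc_vertex (\<lambda>p. row_end (fst p) (snd p))"
    unfolding row_end_def
  proof (rule polytime_foldr_additive[where ea = enc_window and r = "[:3, 1:]"], goal_cases)
    case (4 x W v)
    then show ?case using size_Window_points[of W] by simp
  qed (rule polytime_intros)+
qed

lemma polytime_col_end [polytime_intros]:
  assumes "polytime ec (enc_list enc_window) f" "polytime ec enc_point g"
  shows "polytime ec enc_vertex (\<lambda>x. col_end (f x) (g x))"
proof (rule polytime_comp2[OF _ assms])
  show "polytime (enc_pair (enc_list enc_window) enc_point) enc_vertex (\<lambda>p. col_end (fst p) (snd p))"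
    unfolding col_end_def
  proof (rule polytime_foldr_additive[where ea = enc_window and r = "[:3, 1:]"], goal_cases)
    case (4 x W v)
    then show ?case using size_Window_points[of W] by simp
  qed (rule polytime_intros)+
qed

lemma polytime_tail_of [polytime_intros]:
  "polytime ec enc_window f \<Longrightarrow> polytime ec enc_vertex (\<lambda>x. tail_of (f x))"
proof (erule polytime_comp)
  show "polytime enc_window enc_vertex tail_of"
    unfolding tail_of_def by (rule polytime_intros)+
qed

lemma polytime_head_of [polytime_intros]:
  "polytime ec enc_window f \<Longrightarrow> polytime ec enc_vertex (\<lambda>x. head_of (f x))"
proof (erule polytime_comp)
  show "polytime enc_window enc_vertex head_of"
    unfolding head_of_def by (rule polytime_intros)+
qed

lemma polytime_grid [polytime_intros]:
  "polytime ec enc_tomography f \<Longrightarrow> polytime ec (enc_list enc_point) (\<lambda>x. grid (f x))"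
proof (erule polytime_comp)
  show "polytime enc_tomography (enc_list enc_point) grid"
    unfolding grid_def product_concat_map by (rule polytime_intros)+
qed

lemma polytime_infinity [polytime_intros]:
  "polytime ec enc_tomography f \<Longrightarrow> polytime ec (enc_list enc_point) (\<lambda>x. infinity (f x))"
  unfolding infinity_def by (rule polytime_intros | assumption)+

lemma polytime_forced [polytime_intros]:
  assumes "polytime ec enc_tomography f" "polytime ec enc_window g" "polytime ec ev v"
  shows "polytime ec (enc_list ev) (\<lambda>x. forced (f x) (g x) (v x))"
  unfolding forced_def by (rule polytime_intros assms)+

lemma polytime_free [polytime_intros]:
  assumes "polytime ec enc_tomography f" "polytime ec enc_window g" "polytime ec ev v"
  shows "polytime ec (enc_list ev) (\<lambda>x. free (f x) (g x) (v x))"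
  unfolding free_def
  by (rule polytime_intros assms polytime_comp[OF polytime_snd[OF polytime_var] assms(3)])+

abbreviation enc_arc :: "arc \<Rightarrow> data" where
  "enc_arc \<equiv> enc_edge (enc_option enc_vertex) enc_vertex"

lemma polytime_edges: "polytime enc_tomography (enc_list enc_arc) edges"
  unfolding edges_def cell_def[abs_def] by (rule polytime_intros)+

lemma polytime_demands: "polytime enc_tomography (enc_list enc_vertex) demands"
  unfolding demands_def by (rule polytime_intros)+

lemma polytime_selected: "polytime (enc_list enc_arc) (enc_list enc_nat) selected"
  unfolding selected_def by (rule polytime_intros)+

lemma polytime_solve: "polytime enc_tomography (enc_option (enc_list enc_nat)) solve"
  unfolding solve_def
  by (rule polytime_intros polytime_orient[OF inj_enc_vertex] polytime_edges polytime_demands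
      polytime_comp[OF polytime_fst[OF polytime_var] polytime_selected])+

text \<open>The time steps share no constraint, so a single one without solution decides the whole
  instance.\<close>

definition solve_all :: "inst \<Rightarrow> nat list list option" where
  "solve_all I = foldr (\<lambda>T r. case r of None \<Rightarrow> None | Some xs \<Rightarrow>
    (case solve T of None \<Rightarrow> None | Some x \<Rightarrow> Some (x # xs))) I (Some [])"

lemma polytime_solve_all: "polytime enc_instance (enc_option enc_solution) solve_all"
proof -
  obtain p where p: "size (enc_option (enc_list enc_nat) (solve T)) \<le> poly p (size (enc_tomography T))" for T
    using size_polytime[OF polytime_solve] by blast
  have solve: "polytime ec (enc_option (enc_list enc_nat)) (\<lambda>x. solve (f x))"
    if "polytime ec enc_tomography f" for ec :: "'c \<Rightarrow> data" and f
    using polytime_comp[OF that polytime_solve] .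
  show ?thesis
    unfolding solve_all_def enc_instance_def enc_solution_def
  proof (rule polytime_foldr_additive[where ea = enc_tomography and r = p], goal_cases)
    case (4 I T r)
    have "poly p (size (enc_tomography T)) \<le> poly p (size (enc_tomography T) + size (enc_list enc_tomography I))"
      by (rule poly_nat_mono) simp
    then show ?case
      using p[of T] by (auto split: option.split)
  qed (rule polytime_intros solve)+
qed

lemma solution_list_all2: "solution I xs \<longleftrightarrow> list_all2 ilp_solution I xs"
  by (auto simp: solution_def list_all2_conv_all_nth)

lemma solve_all_correct:
  assumes "\<And>T. T \<in> set I \<Longrightarrow> tomography_in_lines T"
  shows "case solve_all I of None \<Rightarrow> \<not> (\<exists>xs. list_all2 ilp_solution I xs)
    | Some xs \<Rightarrow> list_all2 ilp_solution I xs"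
  using assms
proof (induction I)
  case Nil
  then show ?case by (simp add: solve_all_def)
next
  case (Cons T I)
  interpret tomography_in_lines T
    using Cons.prems by simp
  have IH: "case solve_all I of None \<Rightarrow> \<not> (\<exists>xs. list_all2 ilp_solution I xs)
    | Some xs \<Rightarrow> list_all2 ilp_solution I xs"
    using Cons by simp
  have step: "solve_all (T # I) = (case solve_all I of None \<Rightarrow> None | Some xs \<Rightarrow>
    (case solve T of None \<Rightarrow> None | Some x \<Rightarrow> Some (x # xs)))"
    by (simp add: solve_all_def)
  show ?case
    using IH solve_Some solve_None unfolding step
    by (auto simp: list_all2_Cons1 split: option.split)
qed

lemma tomography_in_lines_instance:
  assumes "valid_instance I" "windows_in_lines I" "windows_disjoint I" "T \<in> set I"
  shows "tomography_in_lines T"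
proof
  obtain t where t: "t < length I" "T = I ! t"
    using assms(4) by (metis in_set_conv_nth)
  show valid: "valid_tomography T"
    using assms(1,4) by (simp add: valid_instance_def)
  have nonempty: "points W \<noteq> []" if "W \<in> set (windows T)" for W
    using valid that by (simp add: valid_tomography_def)
  have disj: "set (points (windows T ! i)) \<inter> set (points (windows T ! j)) = {}"
    if "i < length (windows T)" "j < length (windows T)" "i \<noteq> j" for i j
    using assms(3) t that unfolding windows_disjoint_def by simp
  \<comment> \<open>Equal entries at two positions would be disjoint from themselves, hence without
    points.\<close>
  show "distinct (windows T)"
    unfolding distinct_conv_nth
  proof (intro allI impI notI)
    fix i j
    assume i: "i < length (windows T)" and "j < length (windows T)" "i \<noteq> j"
      "windows T ! i = windows T ! j"
    with disj[of i j] have "points (windows T ! i) = []" by simp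
    with nonempty[OF nth_mem[OF i]] show False by simp
  qed
  show "W = W'" if W: "W \<in> set (windows T)" "W' \<in> set (windows T)"
    and q: "q \<in> set (points W)" "q \<in> set (points W')" for W W' q
  proof -
    obtain i j where "i < length (windows T)" "W = windows T ! i" "j < length (windows T)" "W' = windows T ! j"
      using W by (metis in_set_conv_nth)
    then show ?thesis using disj[of i j] q by (cases "i = j") auto
  qed
  show "horizontal_window W \<or> (\<forall>q\<in>set (points W). fst q = fst (hd (points W)))"
    if W: "W \<in> set (windows T)" for W
  proof -
    obtain i where "i < length (windows T)" "W = windows T ! i"
      using W by (metis in_set_conv_nth)
    then obtain p where p: "set (points W) \<subseteq> UNIV \<times> {snd p} \<or> set (points W) \<subseteq> {fst p} \<times> UNIV"
      using assms(2) t unfolding windows_in_lines_def by blast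
    have hd: "hd (points W) \<in> set (points W)"
      using nonempty[OF W] by simp
    from p have "(\<forall>q\<in>set (points W). snd q = snd p) \<or> (\<forall>q\<in>set (points W). fst q = fst p)"
      by (elim disjE) (simp_all add: subset_iff Ball_def)
    with hd show ?thesis
      unfolding horizontal_window_def by metis
  qed
qed

theorem theorem4p2:
  "poly_time_solvable enc_instance enc_solution
     {I. valid_instance I \<and> windows_in_lines I \<and> windows_disjoint I} solution"
proof -
  obtain P p where P: "implements P 0 p enc_instance (\<lambda>I. enc_option enc_solution (solve_all I))"
    using polytime_solve_all unfolding polytime_def computable_def by blast
  show ?thesis
    unfolding poly_time_solvable_def
  \<comment> \<open>The 2 pays for calling function 0 on its argument; \<open>p\<close> is counted
    once for the time and once for the size of the answer.\<close>
  proof (intro exI[of _ P] exI[of _ "[:2:] + 2 * p"] ballI)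
    fix I
    assume I: "I \<in> {I. valid_instance I \<and> windows_in_lines I \<and> windows_disjoint I}"
    obtain n where n: "eval P [enc_instance I] (Call 0 [Arg 0]) (enc_option enc_solution (solve_all I))
        (1 + (1 + 0) + n)" "n \<le> poly p (size (enc_instance I))"
      using eval_Call[OF P eval_Arg_0] by blast
    have "case solve_all I of None \<Rightarrow> \<not> (\<exists>xs. solution I xs) | Some xs \<Rightarrow> solution I xs"
      unfolding solution_list_all2
      using solve_all_correct tomography_in_lines_instance I by blast
    moreover have "1 + (1 + 0) + n + size (enc_option enc_solution (solve_all I)) \<le>
        poly ([:2:] + 2 * p) (size (enc_instance I))"
      using n(2) size_implements[OF P, of I] by simp
    ultimately show "\<exists>answer n. run P (enc_instance I) (enc_option enc_solution answer) n \<and>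
        n + size (enc_option enc_solution answer) \<le> poly ([:2:] + 2 * p) (size (enc_instance I)) \<and>
        (case answer of None \<Rightarrow> \<not> (\<exists>s. solution I s) | Some s \<Rightarrow> solution I s)"
      using n(1) unfolding run_def by blast
  qed
qed

end
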